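(* For every uncountable set $X\subseteq 2^\omega$ (in the ground model), Miller forcing $\mathbb{M}$ forces that $X$ is not null-additive, i.e. $\mathbb{M}\Vdash$ "$X\notin\mathcal{NA}$".
   Context: $2^\omega$ is the Cantor space with coordinatewise addition modulo 2; $\mathcal{N}$ is the $\sigma$-ideal of Lebesgue measure zero subsets of $2^\omega$. For $X,Y\subseteq 2^\omega$, $X+Y=\{x+y: x\in X, y\in Y\}$. $\mathcal{NA}$ is the class of null-additive sets: $X\in\mathcal{NA}$ iff $X\subseteq 2^\omega$ and $X+N\in\mathcal{N}$ for every $N\in\mathcal{N}$. Miller forcing $\mathbb{M}$ is the collection of all trees $T\subseteq\omega^{<\omega}$ such that every $\sigma\in T$ can be extended to some $\tau\in T$ for which $\{i\in\omega:\tau^\frown i\in T\}$ is infinite, ordered by inclusion. *)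

theory Defs
  imports "HOL-Probability.Probability"
begin

section \<open>The forcing relation\<close>

text \<open>
  HOL plays the role of the ground model. The forcing notion is a type \<open>'p\<close> of class
  \<^class>\<open>order\<close>, where \<open>p \<le> q\<close> means that \<open>p\<close> is the stronger condition. A sentence of the
  forcing language is represented by the predicate "\<open>p\<close> forces it", and the connectives are the
  clauses of the usual recursive definition of the forcing relation. The connectives other than
  negation, conjunction and universal quantification are the classical abbreviations.
\<close>

type_synonym 'p sentence = "'p \<Rightarrow> bool"

definition fNot :: "'p::order sentence \<Rightarrow> 'p sentence" ("\<^bold>\<not> _" [40] 40) where
  "(\<^bold>\<not> \<phi>) = (\<lambda>p. \<forall>q\<le>p. \<not> \<phi> q)"

definition fAnd :: "'p::order sentence \<Rightarrow> 'p sentence \<Rightarrow> 'p sentence" (infixr "\<^bold>\<and>" 35) where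
  "(\<phi> \<^bold>\<and> \<psi>) = (\<lambda>p. \<phi> p \<and> \<psi> p)"

text \<open>
  The bound variable ranges either over a type of names, and thus over the objects of the extension
  named by them, or over a type \<open>'a\<close> of ground-model objects, and thus over the members of the
  check name of \<open>'a\<close>. The second form is only used for hereditarily finite objects (natural numbers,
  finite binary strings, finite sets of these), of which the extension has no new ones.
\<close>

definition fAll :: "('x \<Rightarrow> 'p::order sentence) \<Rightarrow> 'p sentence" (binder "\<^bold>\<forall>" 10) where
  "(\<^bold>\<forall>x. \<Phi> x) = (\<lambda>p. \<forall>x. \<Phi> x p)"

definition fImp :: "'p::order sentence \<Rightarrow> 'p sentence \<Rightarrow> 'p sentence" (infixr "\<^bold>\<longrightarrow>" 25) where
  "(\<phi> \<^bold>\<longrightarrow> \<psi>) = (\<^bold>\<not> (\<phi> \<^bold>\<and> \<^bold>\<not> \<psi>))"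

definition fIff :: "'p::order sentence \<Rightarrow> 'p sentence \<Rightarrow> 'p sentence" (infixr "\<^bold>\<longleftrightarrow>" 25) where
  "(\<phi> \<^bold>\<longleftrightarrow> \<psi>) = ((\<phi> \<^bold>\<longrightarrow> \<psi>) \<^bold>\<and> (\<psi> \<^bold>\<longrightarrow> \<phi>))"

definition fEx :: "('x \<Rightarrow> 'p::order sentence) \<Rightarrow> 'p sentence" (binder "\<^bold>\<exists>" 10) where
  "(\<^bold>\<exists>x. \<Phi> x) = (\<^bold>\<not> (\<^bold>\<forall>x. \<^bold>\<not> \<Phi> x))"

text \<open>An absolute statement about ground-model objects.\<close>

definition fGround :: "bool \<Rightarrow> 'p::order sentence" where
  "fGround b = (\<lambda>p. b)"

definition forced :: "'p::order sentence \<Rightarrow> bool" ("\<^bold>\<tturnstile> _" [10] 10) where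
  "(\<^bold>\<tturnstile> \<phi>) \<longleftrightarrow> (\<forall>p. \<phi> p)"


subsection \<open>Names\<close>

text \<open>
  Every subset in the extension of a ground-model set \<open>'a\<close> has a name that is a set of pairs
  of an element of \<open>'a\<close> and a condition. A point of the Cantor space of the extension is
  identified with the set of coordinates where it is 1, so it is named by a name for a subset
  of \<^typ>\<open>nat\<close>. Similarly, every set of points of the extension is named by a set of pairs of a
  name for a point and a condition.
\<close>

type_synonym ('a, 'p) subset_name = "('a \<times> 'p) set"
type_synonym 'p point_name = "(nat, 'p) subset_name"
type_synonym 'p set_name = "('p point_name \<times> 'p) set"

definition fElem :: "'a \<Rightarrow> ('a, 'p::order) subset_name \<Rightarrow> 'p sentence" (infix "\<^bold>\<in>" 50) where
  "(a \<^bold>\<in> A) = (\<lambda>p. \<forall>q\<le>p. \<exists>r\<le>q. \<exists>s. (a, s) \<in> A \<and> r \<le> s)"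

definition fEq :: "'p::order point_name \<Rightarrow> 'p point_name \<Rightarrow> 'p sentence" where
  "fEq x y = (\<^bold>\<forall>n. n \<^bold>\<in> x \<^bold>\<longleftrightarrow> n \<^bold>\<in> y)"

definition fMem :: "'p::order point_name \<Rightarrow> 'p set_name \<Rightarrow> 'p sentence" where
  "fMem x Y = (\<lambda>p. \<forall>q\<le>p. \<exists>r\<le>q. \<exists>y s. (y, s) \<in> Y \<and> r \<le> s \<and> fEq x y r)"

definition check_point :: "(nat \<Rightarrow> bool) \<Rightarrow> 'p::order point_name" where
  "check_point x = {n. x n} \<times> UNIV"

definition check_set :: "(nat \<Rightarrow> bool) set \<Rightarrow> 'p::order set_name" where
  "check_set X = (check_point ` X) \<times> UNIV"


subsection \<open>Null-additivity in the extension\<close>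

text \<open>The point named by \<open>x\<close> extends the finite binary string \<open>s\<close>.\<close>

definition fPrefix :: "bool list \<Rightarrow> 'p::order point_name \<Rightarrow> 'p sentence" where
  "fPrefix s x = (\<^bold>\<forall>i. fGround (i < length s) \<^bold>\<longrightarrow> (i \<^bold>\<in> x \<^bold>\<longleftrightarrow> fGround (s ! i)))"

text \<open>
  Lebesgue outer measure zero: for every \<open>k\<close> there is a (necessarily countable) set \<open>U\<close> of finite
  binary strings such that the basic clopen sets given by the strings in \<open>U\<close> cover \<open>A\<close> and have total
  measure at most \<open>2\<^sup>-\<^sup>k\<close>. The total is the supremum of the sums over finite subsets.
\<close>

definition fNull :: "('p::order point_name \<Rightarrow> 'p sentence) \<Rightarrow> 'p sentence" where
  "fNull A = (\<^bold>\<forall>k::nat. \<^bold>\<exists>U :: (bool list, 'p) subset_name.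
     (\<^bold>\<forall>F :: bool list set. fGround (finite F) \<^bold>\<and> (\<^bold>\<forall>s. fGround (s \<in> F) \<^bold>\<longrightarrow> s \<^bold>\<in> U)
        \<^bold>\<longrightarrow> fGround ((\<Sum>s\<in>F. (1/2::real) ^ length s) \<le> (1/2) ^ k)) \<^bold>\<and>
     (\<^bold>\<forall>x. A x \<^bold>\<longrightarrow> (\<^bold>\<exists>s. s \<^bold>\<in> U \<^bold>\<and> fPrefix s x)))"

definition fIsSum :: "'p::order point_name \<Rightarrow> 'p point_name \<Rightarrow> 'p point_name \<Rightarrow> 'p sentence" where
  "fIsSum z x y = (\<^bold>\<forall>n. n \<^bold>\<in> z \<^bold>\<longleftrightarrow> \<^bold>\<not> (n \<^bold>\<in> x \<^bold>\<longleftrightarrow> n \<^bold>\<in> y))"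

definition fInSumset :: "'p::order set_name \<Rightarrow> 'p set_name \<Rightarrow> 'p point_name \<Rightarrow> 'p sentence" where
  "fInSumset X Y z = (\<^bold>\<exists>x y. fMem x X \<^bold>\<and> fMem y Y \<^bold>\<and> fIsSum z x y)"

definition fNullAdditive :: "'p::order set_name \<Rightarrow> 'p sentence" where
  "fNullAdditive X =
     (\<^bold>\<forall>N :: 'p set_name. fNull (\<lambda>x. fMem x N) \<^bold>\<longrightarrow> fNull (fInSumset X N))"


section \<open>Miller forcing\<close>

text \<open>Nonemptiness of trees is needed here because the splitting condition holds vacuously for \<open>{}\<close>.\<close>

definition miller_tree :: "nat list set \<Rightarrow> bool" where
  "miller_tree T \<longleftrightarrow> T \<noteq> {} \<and> (\<forall>\<sigma> \<tau>. \<sigma> @ \<tau> \<in> T \<longrightarrow> \<sigma> \<in> T) \<and>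
     (\<forall>\<sigma>\<in>T. \<exists>\<rho>. \<sigma> @ \<rho> \<in> T \<and> infinite {i. \<sigma> @ \<rho> @ [i] \<in> T})"

typedef miller = "{T. miller_tree T}"
  morphisms tree_of Miller
  by (rule exI[of _ UNIV]) (simp add: miller_tree_def)

instantiation miller :: order
begin

definition less_eq_miller :: "miller \<Rightarrow> miller \<Rightarrow> bool" where
  "p \<le> q \<longleftrightarrow> tree_of p \<subseteq> tree_of q"

definition less_miller :: "miller \<Rightarrow> miller \<Rightarrow> bool" where
  "p < q \<longleftrightarrow> tree_of p \<subset> tree_of q"

instance
  by standard (auto simp: less_eq_miller_def less_miller_def tree_of_inject)

end


section \<open>The null-additivity formula agrees with the measure-theoretic notion\<close>

text \<open>
  This section is not used in the statement. It checks the formula \<^const>\<open>fNullAdditive\<close>: for the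
  trivial (one-point) forcing, whose extension is the ground model, the formula is forced iff
  the set is null-additive with respect to the completed coin-tossing measure.
\<close>

definition cantor_measure :: "(nat \<Rightarrow> bool) measure" where
  "cantor_measure = PiM UNIV (\<lambda>_. measure_pmf (bernoulli_pmf (1/2)))"

definition null_ideal :: "(nat \<Rightarrow> bool) set set" where
  "null_ideal = null_sets (completion cantor_measure)"

definition add2 :: "(nat \<Rightarrow> bool) \<Rightarrow> (nat \<Rightarrow> bool) \<Rightarrow> nat \<Rightarrow> bool" where
  "add2 x y = (\<lambda>n. x n \<noteq> y n)"

definition null_additive :: "(nat \<Rightarrow> bool) set \<Rightarrow> bool" where
  "null_additive X \<longleftrightarrow> (\<forall>N \<in> null_ideal. {add2 x y | x y. x \<in> X \<and> y \<in> N} \<in> null_ideal)"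

definition cyl :: "bool list \<Rightarrow> (nat \<Rightarrow> bool) set" where
  "cyl s = {x. \<forall>i<length s. x i = s ! i}"

lemma space_cantor [simp]: "space cantor_measure = UNIV"
  by (simp add: cantor_measure_def space_PiM)

lemma emeasure_cyl: "emeasure cantor_measure (cyl s) = ennreal ((1/2) ^ length s)"
  and sets_cyl [measurable]: "cyl s \<in> sets cantor_measure"
proof -
  interpret product_prob_space "\<lambda>_::nat. measure_pmf (bernoulli_pmf (1/2))" UNIV
    by standard
  let ?C = "{x \<in> space (PiM UNIV (\<lambda>_. measure_pmf (bernoulli_pmf (1/2)))).
    \<forall>i\<in>{..<length s}. x i \<in> {s ! i}}"
  have eq: "cyl s = ?C" by (auto simp: cyl_def space_PiM)
  have "emeasure cantor_measure (cyl s) = (\<Prod>i<length s. ennreal (1/2))"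
    unfolding cantor_measure_def eq
    by (subst emeasure_PiM_Collect) (auto simp: emeasure_pmf_single intro!: prod.cong)
  then show "emeasure cantor_measure (cyl s) = ennreal ((1/2) ^ length s)"
    by (simp only: prod_constant card_lessThan) (simp only: ennreal_power zero_le_divide_1_iff zero_le_numeral)
  show "cyl s \<in> sets cantor_measure"
    unfolding cantor_measure_def eq
    by (intro sets.sets_Collect_finite_All sets_Collect_single) auto
qed

interpretation cantor: prob_space cantor_measure
  unfolding cantor_measure_def by (intro prob_space_PiM measure_pmf.prob_space_axioms)

definition opn :: "(nat \<Rightarrow> bool) set \<Rightarrow> bool" where
  "opn U \<longleftrightarrow> (\<forall>x\<in>U. \<exists>n. \<forall>y. (\<forall>i<n. y i = x i) \<longrightarrow> y \<in> U)"

lemma opn_Un: "(\<And>i. i \<in> I \<Longrightarrow> opn (U i)) \<Longrightarrow> opn (\<Union>i\<in>I. U i)"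
  unfolding opn_def
proof
  fix x assume op: "\<And>i. i \<in> I \<Longrightarrow> \<forall>x\<in>U i. \<exists>n. \<forall>y. (\<forall>i<n. y i = x i) \<longrightarrow> y \<in> U i"
    and "x \<in> (\<Union>i\<in>I. U i)"
  then obtain i where i: "i \<in> I" "x \<in> U i" by blast
  then obtain n where "\<forall>y. (\<forall>i<n. y i = x i) \<longrightarrow> y \<in> U i"
    using op[OF i(1)] by blast
  then show "\<exists>n. \<forall>y. (\<forall>i<n. y i = x i) \<longrightarrow> y \<in> (\<Union>i\<in>I. U i)" using i by blast
qed

lemma opn_Int: assumes "opn U" "opn V" shows "opn (U \<inter> V)"
  unfolding opn_def
proof
  fix x assume x: "x \<in> U \<inter> V"
  obtain m where m: "\<forall>y. (\<forall>i<m. y i = x i) \<longrightarrow> y \<in> U" using assms(1) x unfolding opn_def by blast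
  obtain n where n: "\<forall>y. (\<forall>i<n. y i = x i) \<longrightarrow> y \<in> V" using assms(2) x unfolding opn_def by blast
  have "y \<in> U \<inter> V" if "\<forall>i<max m n. y i = x i" for y
    using m[rule_format, of y] n[rule_format, of y] that by simp
  then show "\<exists>n. \<forall>y. (\<forall>i<n. y i = x i) \<longrightarrow> y \<in> U \<inter> V" by blast
qed

lemma opn_INT: "opn (\<Inter>i<(n::nat). V i)" if "\<And>i. opn (V i)"
proof (induction n)
  case 0 show ?case by (simp add: opn_def)
next
  case (Suc n) then show ?case using that by (simp add: lessThan_Suc opn_Int)
qed

text \<open>Every open set is the disjoint union of a set of cylinders.\<close>
lemma opn_disjoint_cyl:
  assumes "opn U"
  obtains S where "U = (\<Union>s\<in>S. cyl s)" "disjoint_family_on cyl S"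
proof (rule that)
  let ?S = "{s. cyl s \<subseteq> U \<and> (\<forall>m<length s. \<not> cyl (take m s) \<subseteq> U)}"
  show "U = (\<Union>s\<in>?S. cyl s)"
  proof (intro equalityI subsetI)
    fix x assume x: "x \<in> U"
    define P where "P n \<longleftrightarrow> cyl (map x [0..<n]) \<subseteq> U" for n
    obtain n\<^sub>0 where n0: "\<forall>y. (\<forall>i<n\<^sub>0. y i = x i) \<longrightarrow> y \<in> U"
      using assms x unfolding opn_def by blast
    have "P n\<^sub>0" using n0 unfolding P_def cyl_def by auto
    then obtain n where n: "P n" "\<And>m. m < n \<Longrightarrow> \<not> P m" by (metis LeastI not_less_Least)
    have "take m (map x [0..<n]) = map x [0..<m]" if "m < n" for m
      using that by (simp add: take_map)
    then have "map x [0..<n] \<in> ?S" using n by (simp add: P_def)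
    moreover have "x \<in> cyl (map x [0..<n])" by (simp add: cyl_def)
    ultimately show "x \<in> (\<Union>s\<in>?S. cyl s)" by blast
  qed auto
  have *: "length s \<ge> length t" if "s \<in> ?S" "t \<in> ?S" "x \<in> cyl s" "x \<in> cyl t" for s t x
  proof (rule ccontr)
    assume "\<not> length s \<ge> length t"
    then have less: "length s < length t" by simp
    then have eq: "take (length s) t = s"
      using that(3,4) by (intro nth_equalityI) (auto simp: cyl_def)
    have "\<not> cyl (take (length s) t) \<subseteq> U" using that(2) less by simp
    moreover have "cyl s \<subseteq> U" using that(1) by simp
    ultimately show False unfolding eq by simp
  qed
  have "s = t" if "s \<in> ?S" "t \<in> ?S" "x \<in> cyl s" "x \<in> cyl t" for s t x
    using *[OF that] *[OF that(2,1,4,3)] that(3,4)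
    by (intro nth_equalityI) (auto simp: cyl_def)
  then show "disjoint_family_on cyl ?S" unfolding disjoint_family_on_def by blast
qed

lemma sets_opn: "opn U \<Longrightarrow> U \<in> sets cantor_measure"
  by (erule opn_disjoint_cyl) (simp add: sets.countable_UN')

lemma opn_regular:
  assumes "A \<in> sets cantor_measure" "(0::real) < e"
  shows "\<exists>U V. opn U \<and> opn V \<and> A \<subseteq> U \<and> - A \<subseteq> V \<and> measure cantor_measure (U \<inter> V) < e"
  using assms(1)[unfolded cantor_measure_def sets_PiM_single] assms(2)
proof (induction arbitrary: e)
  case (Basic A)
  then obtain i B where A: "A = {f. f i \<in> B}" by (auto simp: space_PiM)
  have "opn A" "opn (- A)" unfolding opn_def A by (auto intro!: exI[of _ "Suc i"])
  with Basic show ?case by (intro exI[of _ A] exI[of _ "- A"]) auto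
next
  case Empty
  then show ?case by (intro exI[of _ "{}"] exI[of _ UNIV]) (auto simp: opn_def)
next
  case (Compl A)
  then obtain U V where "opn U \<and> opn V \<and> A \<subseteq> U \<and> - A \<subseteq> V \<and> measure cantor_measure (U \<inter> V) < e"
    by blast
  then show ?case by (intro exI[of _ V] exI[of _ U]) (auto simp: Int_commute)
next
  case (Union A)
  let ?M = cantor_measure and ?\<mu> = "measure cantor_measure"
  have "\<forall>i. \<exists>U V. opn U \<and> opn V \<and> A i \<subseteq> U \<and> - A i \<subseteq> V \<and> ?\<mu> (U \<inter> V) < e / 4 * (1/2)^i"
    using Union(3) by (intro allI Union(2)) simp
  then obtain U V where UV: "\<And>i. opn (U i)" "\<And>i. opn (V i)" "\<And>i. A i \<subseteq> U i" "\<And>i. - A i \<subseteq> V i"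
    "\<And>i. ?\<mu> (U i \<inter> V i) < e / 4 * (1/2)^i" by metis
  have A[measurable]: "A i \<in> sets ?M" for i
    using Union(1) by (simp add: cantor_measure_def sets_PiM_single)
  note [measurable] = sets_opn[OF UV(1)] sets_opn[OF UV(2)]
  let ?B = "\<lambda>n. (\<Union>i. A i) - (\<Union>i<n. A i)"
  have "(\<lambda>n. ?\<mu> (?B n)) \<longlonglongrightarrow> ?\<mu> (\<Inter>n. ?B n)"
    by (intro cantor.finite_Lim_measure_decseq) (auto simp: decseq_def)
  also have "(\<Inter>n. ?B n) = {}" by auto
  finally have "(\<lambda>n. ?\<mu> (?B n)) \<longlonglongrightarrow> 0" by simp
  then have "\<forall>\<^sub>F n in sequentially. ?\<mu> (?B n) < e / 4"
    using Union(3) by (intro order_tendstoD) auto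
  then obtain n where n: "?\<mu> (?B n) < e / 4" using eventually_sequentially by auto
  have sm: "(\<lambda>i. e / 4 * (1/2)^i) sums (e / 4 * 2)"
    using geometric_sums[of "1/2::real"] by (intro sums_mult) simp
  have sm': "summable (\<lambda>i. ?\<mu> (U i \<inter> V i))"
    by (rule summable_comparison_test'[OF sums_summable[OF sm]]) (use UV(5) less_imp_le in fastforce)
  have "?\<mu> (\<Union>i. U i \<inter> V i) \<le> (\<Sum>i. ?\<mu> (U i \<inter> V i))"
    by (intro cantor.finite_measure_subadditive_countably sm') auto
  also have "\<dots> \<le> e / 2"
    using suminf_le[OF _ sm' sums_summable[OF sm]] UV(5) sums_unique[OF sm] by (simp add: less_imp_le)
  finally have *: "?\<mu> (\<Union>i. U i \<inter> V i) \<le> e / 2" .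
  have "(\<Union>i. U i) \<inter> (\<Inter>i<n. V i) \<subseteq> (\<Union>i. U i \<inter> V i) \<union> ?B n"
  proof
    fix x assume x: "x \<in> (\<Union>i. U i) \<inter> (\<Inter>i<n. V i)"
    then obtain i where i: "x \<in> U i" by blast
    show "x \<in> (\<Union>i. U i \<inter> V i) \<union> ?B n"
    proof (cases "x \<in> (\<Union>i. U i \<inter> V i)")
      case False
      then have "x \<in> A i" using i UV(4)[of i] by auto
      moreover have "x \<notin> A j" if "j < n" for j using False x that UV(3)[of j] by auto
      ultimately show ?thesis by blast
    qed simp
  qed
  then have "?\<mu> ((\<Union>i. U i) \<inter> (\<Inter>i<n. V i)) \<le> ?\<mu> ((\<Union>i. U i \<inter> V i) \<union> ?B n)"
    by (intro cantor.finite_measure_mono) auto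
  also have "\<dots> \<le> ?\<mu> (\<Union>i. U i \<inter> V i) + ?\<mu> (?B n)"
    by (intro measure_Un_le) auto
  also have "\<dots> < e" using * n Union(3) by simp
  finally have "?\<mu> ((\<Union>i. U i) \<inter> (\<Inter>i<n. V i)) < e" .
  moreover have "opn (\<Union>i. U i)" "opn (\<Inter>i<n. V i)"
    by (intro opn_Un UV) (intro opn_INT UV)
  moreover have "(\<Union>i. A i) \<subseteq> (\<Union>i. U i)" "- (\<Union>i. A i) \<subseteq> (\<Inter>i<n. V i)" using UV by fast+
  ultimately show ?case by blast
qed

lemma null_ideal_iff:
  "N \<in> null_ideal \<longleftrightarrow> (\<forall>k::nat. \<exists>U. (\<forall>F. finite F \<and> F \<subseteq> U \<longrightarrow> (\<Sum>s\<in>F. (1/2::real) ^ length s) \<le> (1/2) ^ k)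
      \<and> N \<subseteq> (\<Union>s\<in>U. cyl s))" (is "_ \<longleftrightarrow> (\<forall>k. \<exists>U. ?P k U)")
proof
  assume "N \<in> null_ideal"
  then obtain N' where N': "N' \<in> null_sets cantor_measure" "N \<subseteq> N'"
    by (auto simp: null_ideal_def null_sets_completion_iff2)
  show "\<forall>k. \<exists>U. ?P k U"
  proof
    fix k
    obtain U V where UV: "opn U" "opn V" "N' \<subseteq> U" "- N' \<subseteq> V"
      "measure cantor_measure (U \<inter> V) < (1/2) ^ k"
      using opn_regular[of N' "(1/2)^k"] N' by auto
    have [measurable]: "N' \<in> sets cantor_measure" "U \<in> sets cantor_measure" "V \<in> sets cantor_measure"
      using N' UV sets_opn by auto
    have "measure cantor_measure U \<le> measure cantor_measure (N' \<union> (U \<inter> V))"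
      using UV by (intro cantor.finite_measure_mono) auto
    also have "\<dots> \<le> measure cantor_measure N' + measure cantor_measure (U \<inter> V)"
      by (intro measure_Un_le) auto
    also have "measure cantor_measure N' = 0" using N' by (simp add: null_sets_def measure_def)
    finally have le: "measure cantor_measure U \<le> (1/2) ^ k" using UV by simp
    obtain S where S: "U = (\<Union>s\<in>S. cyl s)" "disjoint_family_on cyl S"
      using opn_disjoint_cyl UV by blast
    have "(\<Sum>s\<in>F. (1/2::real) ^ length s) \<le> (1/2) ^ k" if "finite F" "F \<subseteq> S" for F
    proof -
      have "(\<Sum>s\<in>F. (1/2::real) ^ length s) = (\<Sum>s\<in>F. measure cantor_measure (cyl s))"
        by (simp add: measure_def emeasure_cyl)
      also have "\<dots> = measure cantor_measure (\<Union>s\<in>F. cyl s)"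
        using that S(2) disjoint_family_on_mono
        by (intro cantor.finite_measure_finite_Union[symmetric]) auto
      also have "\<dots> \<le> measure cantor_measure U"
        using S that by (intro cantor.finite_measure_mono) auto
      finally show ?thesis using le by simp
    qed
    then show "\<exists>U. ?P k U" using S N' UV by (intro exI[of _ S]) auto
  qed
next
  assume "\<forall>k. \<exists>U. ?P k U"
  then obtain U where U: "\<And>k. ?P k (U k)" by metis
  let ?O = "\<lambda>k. \<Union>s\<in>U k. cyl s"
  have O[measurable]: "?O k \<in> sets cantor_measure" for k
    by (intro sets.countable_UN') auto
  have le: "emeasure cantor_measure (?O k) \<le> ennreal ((1/2)^k)" for k
  proof -
    let ?B = "\<lambda>m. \<Union>s\<in>{s\<in>U k. to_nat s < m}. cyl s"
    have fin: "finite {s\<in>U k. to_nat s < m}" for m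
      by (rule finite_subset[OF _ finite_vimageI[OF finite_lessThan[of m] inj_to_nat]]) auto
    have "emeasure cantor_measure (\<Union>m. ?B m) = (SUP m. emeasure cantor_measure (?B m))"
      using fin by (intro SUP_emeasure_incseq[symmetric]) (auto simp: incseq_def)
    also have "\<dots> \<le> ennreal ((1/2)^k)"
    proof (rule SUP_least)
      fix m
      have "emeasure cantor_measure (?B m) \<le> (\<Sum>s\<in>{s\<in>U k. to_nat s < m}. emeasure cantor_measure (cyl s))"
        using fin by (intro emeasure_subadditive_finite) auto
      also have "\<dots> = ennreal (\<Sum>s\<in>{s\<in>U k. to_nat s < m}. (1/2) ^ length s)"
        by (simp add: emeasure_cyl)
      also have "\<dots> \<le> ennreal ((1/2)^k)"
        using U[of k] fin[of m] by (intro ennreal_leI) blast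
      finally show "emeasure cantor_measure (?B m) \<le> ennreal ((1/2)^k)" .
    qed
    also have "(\<Union>m. ?B m) = ?O k" by auto
    finally show ?thesis .
  qed
  have "emeasure cantor_measure (\<Inter>k. ?O k) \<le> ennreal ((1/2)^k)" for k
  proof -
    have "emeasure cantor_measure (\<Inter>k. ?O k) \<le> emeasure cantor_measure (?O k)"
      by (rule emeasure_mono[OF _ O]) blast
    then show ?thesis using le[of k] by (rule order_trans)
  qed
  then have *: "measure cantor_measure (\<Inter>k. ?O k) \<le> (1/2)^k" for k
    by (simp add: cantor.emeasure_eq_measure)
  have "measure cantor_measure (\<Inter>k. ?O k) \<le> 0"
    by (rule LIMSEQ_le_const[OF LIMSEQ_power_zero[of "1/2::real"]]) (use * in auto)
  then have "emeasure cantor_measure (\<Inter>k. ?O k) = 0"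
    by (simp add: cantor.emeasure_eq_measure ennreal_neg)
  moreover have "(\<Inter>k. ?O k) \<in> sets cantor_measure" by measurable
  ultimately have "(\<Inter>k. ?O k) \<in> null_sets cantor_measure" by blast
  moreover have "N \<subseteq> (\<Inter>k. ?O k)" using U by blast
  ultimately show "N \<in> null_ideal"
    unfolding null_ideal_def null_sets_completion_iff2 by blast
qed

lemma unit_simps:
  fixes \<phi> \<psi> :: "unit sentence"
  shows "(\<^bold>\<not> \<phi>) p \<longleftrightarrow> \<not> \<phi> p" "(\<phi> \<^bold>\<and> \<psi>) p \<longleftrightarrow> \<phi> p \<and> \<psi> p"
    "(\<phi> \<^bold>\<longrightarrow> \<psi>) p \<longleftrightarrow> (\<phi> p \<longrightarrow> \<psi> p)" "(\<phi> \<^bold>\<longleftrightarrow> \<psi>) p \<longleftrightarrow> (\<phi> p \<longleftrightarrow> \<psi> p)"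
    "(\<^bold>\<forall>x. \<Phi> x) p \<longleftrightarrow> (\<forall>x. \<Phi> x (p::unit))" "(\<^bold>\<exists>x. \<Phi> x) p \<longleftrightarrow> (\<exists>x. \<Phi> x (p::unit))"
    "fGround b p \<longleftrightarrow> b" "(a \<^bold>\<in> A) p \<longleftrightarrow> (a, p) \<in> A" 
  by (auto simp: fNot_def fAnd_def fAll_def fImp_def fIff_def fEx_def fGround_def fElem_def)

lemma surj_unit_check_point: "surj (check_point :: _ \<Rightarrow> unit point_name)"
  by (rule surjI[where f = "\<lambda>x n. (n, ()) \<in> x"]) (auto simp: check_point_def)

lemma unit_ex_name: "(\<exists>x :: unit point_name. P x) \<longleftrightarrow> (\<exists>x. P (check_point x))"
  and unit_all_name: "(\<forall>x :: unit point_name. P x) \<longleftrightarrow> (\<forall>x. P (check_point x))"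
  by (metis surj_unit_check_point surj_def)+

lemma unit_elem: "(n \<^bold>\<in> check_point x) (p::unit) \<longleftrightarrow> x n"
  by (simp add: unit_simps check_point_def)

lemma unit_fEq: "fEq (check_point x) (check_point y) (p::unit) \<longleftrightarrow> x = y"
  by (auto simp: fEq_def unit_simps(1-7) unit_elem)

definition denote :: "unit set_name \<Rightarrow> (nat \<Rightarrow> bool) set" where
  "denote Y = {x. (check_point x, ()) \<in> Y}"

lemma unit_fMem: "fMem (check_point x) Y p \<longleftrightarrow> x \<in> denote Y"
  by (simp add: fMem_def denote_def unit_ex_name unit_fEq)

lemma denote_check: "denote (check_set X) = X"
proof -
  have "inj (check_point :: _ \<Rightarrow> unit point_name)"
    by (rule injI) (metis unit_fEq)
  then show ?thesis by (auto simp: denote_def check_set_def inj_def)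
qed

lemma surj_denote: "\<exists>Y. denote Y = X"
  using denote_check by blast

lemma fNull_unit: "fNull A (p::unit) \<longleftrightarrow> {x. A (check_point x) p} \<in> null_ideal"
proof -
  have pre: "fPrefix s (check_point x) q \<longleftrightarrow> x \<in> cyl s" for s x and q :: unit
    by (auto simp: fPrefix_def unit_simps(1-7) unit_elem cyl_def)
  have ex: "(\<exists>U :: (bool list, unit) subset_name. P U) \<longleftrightarrow> (\<exists>S. P (S \<times> UNIV))" for P
  proof
    assume "\<exists>U. P U" then obtain U where "P U" by blast
    moreover have "U = {s. (s, ()) \<in> U} \<times> UNIV" by auto
    ultimately show "\<exists>S. P (S \<times> UNIV)" by metis
  qed blast
  show ?thesis
    unfolding fNull_def null_ideal_iff
    by (simp add: unit_simps unit_all_name ex pre subset_iff Bex_def)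
qed

lemma trivial_forcing_null_additive:
  "(\<^bold>\<tturnstile> fNullAdditive (check_set X :: unit set_name)) \<longleftrightarrow> null_additive X"
proof -
  have sum: "fInSumset Y N (check_point z) p \<longleftrightarrow> z \<in> {add2 x y | x y. x \<in> denote Y \<and> y \<in> denote N}" for Y N z p
    by (auto simp: fInSumset_def fIsSum_def unit_simps(1-7) unit_elem unit_ex_name unit_fMem add2_def fun_eq_iff)
  have "(\<^bold>\<tturnstile> fNullAdditive (check_set X :: unit set_name)) \<longleftrightarrow>
    (\<forall>Y. denote Y \<in> null_ideal \<longrightarrow> {add2 x y | x y. x \<in> X \<and> y \<in> denote Y} \<in> null_ideal)"
    by (simp add: forced_def fNullAdditive_def unit_simps(1-7) fNull_unit unit_fMem sum denote_check)
  also have "\<dots> \<longleftrightarrow> null_additive X"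
  proof
    assume L: "\<forall>Y. denote Y \<in> null_ideal \<longrightarrow> {add2 x y | x y. x \<in> X \<and> y \<in> denote Y} \<in> null_ideal"
    show "null_additive X"
      unfolding null_additive_def
    proof
      fix N assume "N \<in> null_ideal"
      moreover obtain Y where "denote Y = N" using surj_denote by blast
      ultimately show "{add2 x y | x y. x \<in> X \<and> y \<in> N} \<in> null_ideal" using L by blast
    qed
  qed (simp add: null_additive_def)
  finally show ?thesis .
qed

end

theory Submission
  imports Defs "HOL-Library.Sublist"
begin

text \<open>
  Let \<open>g\<close> be the Miller real and let \<open>C n l\<close> be the clopen set of all \<open>z\<close> for which a block of \<open>n\<close>
  bits of \<open>z\<close>, at a position coded by the first \<open>l\<close> bits of \<open>z\<close>, vanishes. It has measure \<open>2\<^sup>-\<^sup>n\<close>,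
  and its translates by points with different restrictions to \<open>l\<close> are independent, because inside
  each cylinder of length \<open>l\<close> they constrain disjoint blocks. The null set to consider is
  \<open>N = limsup\<^sub>n C n (g n)\<close>.

  Suppose that \<open>X + N\<close> is covered by an open set \<open>U\<close> of measure at most \<open>1/2\<close>. By a Baire category
  argument in the complement of \<open>U\<close>, for each \<open>x \<in> X\<close> there are a cylinder \<open>s\<close>, not almost contained in
  \<open>U\<close>, and an \<open>m\<close> such that \<open>s \<inter> (x + C n (g n))\<close> is almost contained in \<open>U\<close> for all \<open>n \<ge> m\<close>. By
  independence, the points \<open>x\<close> that work for \<open>s\<close> have at most \<open>M\<close> restrictions to \<open>g n\<close>, where \<open>M\<close>
  depends only on \<open>n\<close> and on the measure of \<open>s\<close> outside \<open>U\<close>. A fusion yields a Miller tree that decides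
  the set of these restrictions at every immediate successor \<open>\<sigma> @ [i]\<close> of a splitting node. Given at
  most \<open>M\<close> strings of each length \<open>i\<close>, an infinite set of indices \<open>i\<close> can be thinned out so that only
  finitely many points have infinitely many of their restrictions among the strings. So each of the
  countably many splitting nodes captures only finitely many points of \<open>X\<close>, and \<open>X\<close> is countable.
\<close>

subsection \<open>Independent blocks of coordinates\<close>

definition flip :: "nat \<Rightarrow> (nat \<Rightarrow> bool) \<Rightarrow> nat \<Rightarrow> bool" where
  "flip a z = z(a := \<not> z a)"

lemma measurable_flip [measurable]: "flip a \<in> cantor_measure \<rightarrow>\<^sub>M cantor_measure"
  unfolding flip_def cantor_measure_def
  by (rule measurable_fun_upd[where J = UNIV]) auto

text \<open>The fair coin is invariant under \<open>Not\<close>, so the two measures agree on the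
  finite-dimensional cylinders \<open>prod_emb\<close>, and these determine a measure on the
  product.\<close>

lemma distr_flip: "distr cantor_measure cantor_measure (flip a) = cantor_measure"
proof -
  interpret product_prob_space "\<lambda>_::nat. measure_pmf (bernoulli_pmf (1/2))" UNIV
    by standard
  have bern: "measure_pmf.prob (bernoulli_pmf (1/2)) (Not -` A) = measure_pmf.prob (bernoulli_pmf (1/2)) A" for A
  proof -
    have "pmf (map_pmf Not (bernoulli_pmf (1/2))) b = pmf (bernoulli_pmf (1/2)) b" for b
    proof -
      have "Not -` {b} = {\<not> b}" by auto
      then show ?thesis by (simp add: pmf_map measure_pmf_single)
    qed
    then have "map_pmf Not (bernoulli_pmf (1/2)) = bernoulli_pmf (1/2)" by (rule pmf_eqI)
    then show ?thesis by (metis measure_map_pmf)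
  qed
  show ?thesis
    unfolding cantor_measure_def
  proof (rule measure_eqI_PiM_infinite)
    fix A :: "nat \<Rightarrow> bool set" and J :: "nat set"
    assume J: "finite J"
    let ?M = "\<lambda>_::nat. measure_pmf (bernoulli_pmf (1/2))"
    let ?A = "\<lambda>i. if i = a then Not -` A i else A i"
    have "flip a -` prod_emb UNIV ?M J (Pi\<^sub>E J A) = prod_emb UNIV ?M J (Pi\<^sub>E J ?A)"
      by (auto simp: prod_emb_def flip_def Pi_def space_PiM PiE_def split: if_splits)
    moreover have "emeasure (PiM UNIV ?M) (prod_emb UNIV ?M J (Pi\<^sub>E J ?A)) = emeasure (PiM UNIV ?M) (prod_emb UNIV ?M J (Pi\<^sub>E J A))"
      using J bern by (subst (1 2) emeasure_PiM_emb) (auto intro!: prod.cong simp: measure_pmf.emeasure_eq_measure)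
    ultimately show "emeasure (distr (PiM UNIV ?M) (PiM UNIV ?M) (flip a)) (prod_emb UNIV ?M J (Pi\<^sub>E J A)) =
        emeasure (PiM UNIV ?M) (prod_emb UNIV ?M J (Pi\<^sub>E J A))"
      using J measurable_flip[of a] by (subst emeasure_distr) (auto simp: cantor_measure_def space_PiM)
  qed (use measurable_flip[of a] in \<open>auto simp: cantor_measure_def intro!: finite_measure.finite_measure_distr\<close>)
qed

lemma measure_flip:
  assumes "B \<in> sets cantor_measure"
  shows "measure cantor_measure (flip a -` B) = measure cantor_measure B"
  using assms by (subst (2) distr_flip[of a, symmetric]) (simp add: measure_distr)

lemma sets_coordinate [measurable]: "{z. z (a::nat) = b} \<in> sets cantor_measure"
  by (intro sets_opn) (auto simp: opn_def intro!: exI[of _ "Suc a"])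

text \<open>Flipping bit \<open>a\<close> preserves the measure and exchanges the two parts of
  \<open>B\<close> given by the value of that bit.\<close>

lemma measure_halve:
  assumes [measurable]: "B \<in> sets cantor_measure" and inv: "flip a -` B = B"
  shows "measure cantor_measure (B \<inter> {z. z a = b}) = measure cantor_measure B / 2"
proof -
  have "measure cantor_measure (B \<inter> {z. z a = (\<not> b)}) = measure cantor_measure (flip a -` (B \<inter> {z. z a = (\<not> b)}))"
    by (rule measure_flip[symmetric]) measurable
  also have "flip a -` (B \<inter> {z. z a = (\<not> b)}) = B \<inter> {z. z a = b}"
    using inv by (auto simp: flip_def)
  finally have "measure cantor_measure (B \<inter> {z. z a = (\<not> b)}) = measure cantor_measure (B \<inter> {z. z a = b})" .
  moreover have "measure cantor_measure (B \<inter> {z. z a = b} \<union> B \<inter> {z. z a = (\<not> b)}) =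
      measure cantor_measure (B \<inter> {z. z a = b}) + measure cantor_measure (B \<inter> {z. z a = (\<not> b)})"
    by (rule cantor.finite_measure_Union) (measurable, blast)
  moreover have "B \<inter> {z. z a = b} \<union> B \<inter> {z. z a = (\<not> b)} = B" by blast
  ultimately show ?thesis by simp
qed

text \<open>The bits of the block are fixed one at a time, each halving the measure because the set
  built so far is invariant under flipping the next bit. Measurability belongs to the conclusion
  because the induction step needs it for \<open>measure_halve\<close>.\<close>

lemma measure_block:
  assumes B: "B \<in> sets cantor_measure" and inv: "\<And>j. a \<le> j \<Longrightarrow> j < a + n \<Longrightarrow> flip j -` B = B"
  shows "measure cantor_measure (B \<inter> {z. \<forall>t<n. z (a + t) = w (a + t)}) = measure cantor_measure B * (1/2) ^ n
    \<and> B \<inter> {z. \<forall>t<n. z (a + t) = w (a + t)} \<in> sets cantor_measure"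
  using inv
proof (induction n)
  case (Suc n)
  let ?B = "B \<inter> {z. \<forall>t<n. z (a + t) = w (a + t)}"
  have "measure cantor_measure ?B = measure cantor_measure B * (1/2) ^ n \<and> ?B \<in> sets cantor_measure"
    by (rule Suc.IH) (rule Suc.prems, auto)
  then have IH: "measure cantor_measure ?B = measure cantor_measure B * (1/2) ^ n" and B': "?B \<in> sets cantor_measure"
    by blast+
  have eq: "B \<inter> {z. \<forall>t<Suc n. z (a + t) = w (a + t)} = ?B \<inter> {z. z (a + n) = w (a + n)}"
    by (auto simp: less_Suc_eq)
  have inv: "flip (a + n) -` ?B = ?B"
  proof (rule set_eqI)
    fix z
    have "flip (a + n) -` B = B" by (rule Suc.prems) auto
    then have "flip (a + n) z \<in> B \<longleftrightarrow> z \<in> B" by (metis vimage_eq)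
    moreover have "(\<forall>t<n. flip (a + n) z (a + t) = w (a + t)) \<longleftrightarrow> (\<forall>t<n. z (a + t) = w (a + t))"
      by (simp add: flip_def)
    ultimately show "z \<in> flip (a + n) -` ?B \<longleftrightarrow> z \<in> ?B" by blast
  qed
  have "measure cantor_measure (?B \<inter> {z. z (a + n) = w (a + n)}) = measure cantor_measure ?B / 2"
    by (rule measure_halve[OF B' inv])
  moreover have "?B \<inter> {z. z (a + n) = w (a + n)} \<in> sets cantor_measure"
    by (rule sets.Int[OF B' sets_coordinate])
  ultimately show ?case unfolding eq using IH by simp
qed (use B in simp)

subsection \<open>Clopen sets with independent translates\<close>

definition res :: "(nat \<Rightarrow> bool) \<Rightarrow> nat \<Rightarrow> bool list" where
  "res z l = map z [0..<l]"

lemma length_res [simp]: "length (res z l) = l"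
  by (simp add: res_def)

lemma nth_res [simp]: "i < l \<Longrightarrow> res z l ! i = z i"
  by (simp add: res_def)

lemma res_eq_iff: "res z l = s \<longleftrightarrow> length s = l \<and> z \<in> cyl s"
  by (auto simp: cyl_def list_eq_iff_nth_eq)

lemma res_eq_res_iff: "res z l = res y l \<longleftrightarrow> (\<forall>i<l. z i = y i)"
  by (auto simp: list_eq_iff_nth_eq)

lemma disjoint_cyl: "length s = length t \<Longrightarrow> s \<noteq> t \<Longrightarrow> cyl s \<inter> cyl t = {}"
  using res_eq_iff[of _ "length s"] by (metis disjoint_iff)

lemma finite_strings: "finite {s::bool list. length s = l}" "finite {s::bool list. length s \<le> l}"
  using finite_lists_length_eq[of "UNIV::bool set" l] finite_lists_length_le[of "UNIV::bool set" l] by auto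

text \<open>By injectivity of \<open>to_nat\<close>, every string of length \<open>l\<close> owns a
  block of \<open>n\<close> positions, all beyond the first \<open>l\<close> and disjoint from the
  blocks of the other strings.\<close>

definition Cset :: "nat \<Rightarrow> nat \<Rightarrow> (nat \<Rightarrow> bool) set" where
  "Cset n l = {z. \<forall>t<n. \<not> z (l + n * to_nat (res z l) + t)}"

text \<open>The end of the last block, so the first \<open>Clen n l\<close> bits decide membership
  in \<open>Cset n l\<close>.\<close>

definition Clen :: "nat \<Rightarrow> nat \<Rightarrow> nat" where
  "Clen n l = l + n * Suc (Max (to_nat ` {v::bool list. length v = l}))"

lemma Cset_local:
  assumes "\<forall>i<Clen n l. z i = y i"
  shows "z \<in> Cset n l \<longleftrightarrow> y \<in> Cset n l"
proof -
  have "z \<in> Cset n l \<Longrightarrow> y \<in> Cset n l" if *: "\<forall>i<Clen n l. z i = y i" for z y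
  proof -
    assume z: "z \<in> Cset n l"
    have "res z l = res y l" using * by (auto simp: res_eq_res_iff Clen_def)
    moreover have "l + n * to_nat (res y l) + t < Clen n l" if "t < n" for t
    proof -
      have "to_nat (res y l) \<le> Max (to_nat ` {v::bool list. length v = l})"
        using finite_strings by (intro Max_ge) auto
      then have "n * to_nat (res y l) \<le> n * Max (to_nat ` {v::bool list. length v = l})" by simp
      then show ?thesis using that by (simp add: Clen_def add.commute add_less_le_mono)
    qed
    ultimately show "y \<in> Cset n l" using z * by (auto simp: Cset_def)
  qed
  from this[of z y] this[of y z] assms show ?thesis by auto
qed

lemma opn_local:
  assumes "\<And>z y. \<forall>i<L. z i = y i \<Longrightarrow> z \<in> A \<Longrightarrow> y \<in> A"
  shows "opn A"
  unfolding opn_def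
proof (intro ballI exI allI impI)
  fix z y assume "z \<in> A" "\<forall>i<L. y i = z i"
  then show "y \<in> A" by (intro assms[of z y]) auto
qed

text \<open>Every point is its own inverse modulo 2, so this preimage is the translate
  \<open>x + A\<close>.\<close>

definition translate :: "(nat \<Rightarrow> bool) \<Rightarrow> (nat \<Rightarrow> bool) set \<Rightarrow> (nat \<Rightarrow> bool) set" where
  "translate x A = {z. add2 z x \<in> A}"

lemma translate_Cset_local: "\<forall>i<Clen n l. z i = y i \<Longrightarrow> z \<in> translate x (Cset n l) \<longleftrightarrow> y \<in> translate x (Cset n l)"
  unfolding translate_def mem_Collect_eq by (rule Cset_local) (simp add: add2_def)

lemma sets_translate_Cset [measurable]: "translate x (Cset n l) \<in> sets cantor_measure"
proof (intro sets_opn opn_local)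
  fix z y assume "\<forall>i<Clen n l. z i = y i" "z \<in> translate x (Cset n l)"
  then show "y \<in> translate x (Cset n l)" using translate_Cset_local by blast
qed

lemma measure_cyl: "measure cantor_measure (cyl s) = (1/2) ^ length s"
  by (simp add: measure_def emeasure_cyl)

lemma block_disjoint:
  assumes "(i::nat) \<noteq> j"
  shows "l + n * i + n \<le> l + n * j \<or> l + n * j + n \<le> l + n * i"
proof -
  have "n * Suc i \<le> n * j \<or> n * Suc j \<le> n * i"
    using assms by (metis Suc_leI linorder_neqE_nat mult_le_mono2)
  then show ?thesis by (simp add: add.commute)
qed

text \<open>On \<open>cyl u\<close> the first \<open>l\<close> bits of \<open>z\<close> are known,
  so the translate by \<open>x\<close> becomes the condition \<open>E x\<close> that
  \<open>z\<close> agrees with \<open>x\<close> on one fixed block. Points with different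
  restrictions get disjoint blocks, so each removal multiplies the measure by
  \<open>1 - (1/2) ^ n\<close>.\<close>

lemma cyl_avoid_translates:
  assumes "finite J" "inj_on (\<lambda>x. res x l) J" "length u = l"
  shows "measure cantor_measure (cyl u - (\<Union>x\<in>J. translate x (Cset n l))) = (1/2) ^ l * (1 - (1/2) ^ n) ^ card J"
proof -
  define a where "a x = l + n * to_nat (res (add2 (\<lambda>i. u ! i) x) l)" for x
  define E where "E x = {z. \<forall>t<n. z (a x + t) = x (a x + t)}" for x
  have E[measurable]: "E x \<in> sets cantor_measure" for x
    by (intro sets_opn opn_local[of "a x + n"]) (auto simp: E_def)
  have tE: "z \<in> translate x (Cset n l) \<longleftrightarrow> z \<in> E x" if z: "z \<in> cyl u" for z x
  proof -
    have "res (add2 z x) l = res (add2 (\<lambda>i. u ! i) x) l"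
      using z assms(3) by (auto simp: res_eq_res_iff add2_def cyl_def)
    then show ?thesis by (auto simp: translate_def Cset_def E_def a_def add2_def)
  qed
  have "measure cantor_measure (cyl u - (\<Union>x\<in>J. E x)) = (1/2) ^ l * (1 - (1/2) ^ n) ^ card J"
    using assms(1,2)
  proof (induction J)
    case empty
    then show ?case using assms(3) by (simp add: measure_cyl)
  next
    case (insert x J)
    let ?B = "cyl u - (\<Union>x\<in>J. E x)"
    have B[measurable]: "?B \<in> sets cantor_measure" using insert.hyps by (intro sets.Diff sets.finite_UN) auto
    have IH: "measure cantor_measure ?B = (1/2) ^ l * (1 - (1/2) ^ n) ^ card J" using insert by auto
    \<comment> \<open>The block of \<open>x\<close> lies beyond the first \<open>l\<close> positions
      and misses the blocks of the points in \<open>J\<close>, so its bits are free in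
      \<open>?B\<close>.\<close>
    have inv: "flip j -` ?B = ?B" if j: "a x \<le> j" "j < a x + n" for j
    proof -
      have 1: "flip j z \<in> cyl u \<longleftrightarrow> z \<in> cyl u" for z
      proof -
        have "l \<le> j" using j by (simp add: a_def)
        then show ?thesis using assms(3) by (auto simp: cyl_def flip_def)
      qed
      have 2: "flip j z \<in> E y \<longleftrightarrow> z \<in> E y" if y: "y \<in> J" for z y
      proof -
        have "res x l \<noteq> res y l" using insert.prems insert.hyps y by (auto simp: inj_on_def)
        then have "res (add2 (\<lambda>i. u ! i) x) l \<noteq> res (add2 (\<lambda>i. u ! i) y) l"
          by (auto simp: res_eq_res_iff add2_def)
        then have "to_nat (res (add2 (\<lambda>i. u ! i) x) l) \<noteq> to_nat (res (add2 (\<lambda>i. u ! i) y) l)" by simp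
        then have "a x + n \<le> a y \<or> a y + n \<le> a x"
          unfolding a_def by (intro block_disjoint)
        then have "a y + t \<noteq> j" if "t < n" for t using j that by auto
        then show ?thesis by (auto simp: E_def flip_def)
      qed
      show ?thesis using 1 2 by auto
    qed
    have "measure cantor_measure (?B \<inter> E x) = measure cantor_measure ?B * (1/2) ^ n"
      unfolding E_def using measure_block[OF B inv] by (simp add: E_def)
    moreover have "cyl u - (\<Union>x\<in>insert x J. E x) = ?B - ?B \<inter> E x" by blast
    moreover have "measure cantor_measure (?B - ?B \<inter> E x) = measure cantor_measure ?B - measure cantor_measure (?B \<inter> E x)"
      using B E by (intro cantor.finite_measure_Diff) auto
    ultimately show ?case using insert.hyps IH by (simp add: algebra_simps)
  qed
  moreover have "cyl u - (\<Union>x\<in>J. translate x (Cset n l)) = cyl u - (\<Union>x\<in>J. E x)" using tE by blast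
  ultimately show ?thesis by simp
qed

text \<open>The value on \<open>cyl u\<close> does not depend on \<open>u\<close>; sum it over the
  \<open>2 ^ l\<close> strings of length \<open>l\<close>.\<close>

lemma measure_avoid_translates:
  assumes "finite J" "inj_on (\<lambda>x. res x l) J"
  shows "measure cantor_measure (- (\<Union>x\<in>J. translate x (Cset n l))) = (1 - (1/2) ^ n) ^ card J"
proof -
  let ?D = "\<Union>x\<in>J. translate x (Cset n l)" and ?S = "{u::bool list. length u = l}"
  have D: "?D \<in> sets cantor_measure" using assms by auto
  have "- ?D = (\<Union>u\<in>?S. cyl u - ?D)"
  proof (intro equalityI subsetI)
    fix z assume "z \<in> - ?D"
    moreover have "z \<in> cyl (res z l)" by (simp add: cyl_def)
    ultimately show "z \<in> (\<Union>u\<in>?S. cyl u - ?D)" by (intro UN_I[of "res z l"]) auto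
  qed blast
  then have "measure cantor_measure (- ?D) = measure cantor_measure (\<Union>u\<in>?S. cyl u - ?D)" by simp
  also have "\<dots> = (\<Sum>u\<in>?S. measure cantor_measure (cyl u - ?D))"
  proof (intro cantor.finite_measure_finite_Union finite_strings)
    show "disjoint_family_on (\<lambda>u. cyl u - ?D) ?S"
      using disjoint_cyl unfolding disjoint_family_on_def mem_Collect_eq by blast
  qed (use D in auto)
  also have "\<dots> = (\<Sum>u\<in>?S. (1/2) ^ l * (1 - (1/2) ^ n) ^ card J)"
    using cyl_avoid_translates[OF assms] by (intro sum.cong) auto
  also have "\<dots> = (1 - (1/2) ^ n) ^ card J"
    using card_lists_length_eq[of "UNIV::bool set" l] by (simp add: power_one_over)
  finally show ?thesis .
qed

text \<open>The case of a single translate, by the zero point.\<close>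

lemma measure_Cset: "measure cantor_measure (Cset n l) = (1/2) ^ n"
proof -
  have "translate (\<lambda>_. False) (Cset n l) = Cset n l" by (simp add: translate_def add2_def)
  moreover from this have "Cset n l \<in> sets cantor_measure" using sets_translate_Cset by metis
  ultimately show ?thesis
    using measure_avoid_translates[of "{\<lambda>_. False}" l n] cantor.prob_compl[of "Cset n l"]
    by (simp add: Compl_eq_Diff_UNIV)
qed

text \<open>Strings of length \<open>Clen n l\<close> are long enough to decide membership, so the
  cylinders of those collected here partition \<open>Cset n l\<close>.\<close>

definition Cstrings :: "nat \<Rightarrow> nat \<Rightarrow> bool list set" where
  "Cstrings n l = {s. length s = Clen n l \<and> cyl s \<subseteq> Cset n l}"

lemma finite_Cstrings: "finite (Cstrings n l)"
  using finite_strings(1)[of "Clen n l"] by (rule rev_finite_subset) (auto simp: Cstrings_def)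

lemma sum_Cstrings: "(\<Sum>s\<in>Cstrings n l. (1/2::real) ^ length s) \<le> (1/2) ^ n"
proof -
  have "translate (\<lambda>_. False) (Cset n l) = Cset n l" by (simp add: translate_def add2_def)
  then have C: "Cset n l \<in> sets cantor_measure" using sets_translate_Cset by metis
  have "(\<Sum>s\<in>Cstrings n l. (1/2::real) ^ length s) = (\<Sum>s\<in>Cstrings n l. measure cantor_measure (cyl s))"
    by (simp add: measure_cyl)
  also have "\<dots> = measure cantor_measure (\<Union>s\<in>Cstrings n l. cyl s)"
  proof (intro cantor.finite_measure_finite_Union[symmetric] finite_Cstrings)
    show "disjoint_family_on cyl (Cstrings n l)"
      unfolding disjoint_family_on_def by (intro ballI impI disjoint_cyl) (simp_all add: Cstrings_def)
  qed (simp add: image_subset_iff)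
  also have "\<dots> \<le> measure cantor_measure (Cset n l)"
    using C by (intro cantor.finite_measure_mono) (auto simp: Cstrings_def)
  finally show ?thesis by (simp add: measure_Cset)
qed

subsection \<open>Miller trees\<close>

definition splits :: "miller \<Rightarrow> nat list \<Rightarrow> bool" where
  "splits p \<sigma> \<longleftrightarrow> infinite {i. \<sigma> @ [i] \<in> tree_of p}"

lemma miller_tree_tree_of: "miller_tree (tree_of p)"
  using tree_of by simp

lemma tree_of_prefix: "\<tau> \<in> tree_of p \<Longrightarrow> prefix \<sigma> \<tau> \<Longrightarrow> \<sigma> \<in> tree_of p"
  using miller_tree_tree_of[of p] by (auto simp: miller_tree_def prefix_def)

lemma splits_in_tree: "splits p \<sigma> \<Longrightarrow> \<sigma> \<in> tree_of p"
  unfolding splits_def by (drule not_finite_existsD) (auto intro: tree_of_prefix)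

lemma ex_splits_extension: "\<sigma> \<in> tree_of p \<Longrightarrow> \<exists>\<tau>. prefix \<sigma> \<tau> \<and> splits p \<tau>"
proof -
  assume "\<sigma> \<in> tree_of p"
  then obtain \<rho> where "infinite {i. \<sigma> @ \<rho> @ [i] \<in> tree_of p}"
    using miller_tree_tree_of[of p] unfolding miller_tree_def by blast
  then show ?thesis by (intro exI[of _ "\<sigma> @ \<rho>"]) (simp add: splits_def)
qed

lemma Nil_in_tree: "[] \<in> tree_of p"
proof -
  obtain \<tau> where "\<tau> \<in> tree_of p" using miller_tree_tree_of[of p] by (auto simp: miller_tree_def)
  then show ?thesis by (rule tree_of_prefix) simp
qed

lemma ex_splits_long: "\<exists>\<tau>. splits p \<tau> \<and> n \<le> length \<tau>"
proof (induction n)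
  case 0
  then show ?case using ex_splits_extension[OF Nil_in_tree] by auto
next
  case (Suc n)
  then obtain \<tau> where \<tau>: "splits p \<tau>" "n \<le> length \<tau>" by blast
  then obtain i where "\<tau> @ [i] \<in> tree_of p" using not_finite_existsD unfolding splits_def by blast
  then obtain \<rho> where "prefix (\<tau> @ [i]) \<rho>" "splits p \<rho>" using ex_splits_extension by blast
  then show ?case using \<tau>(2) prefix_length_le[of "\<tau> @ [i]" \<rho>] by auto
qed

lemma miller_treeI:
  assumes "T \<noteq> {}" "\<And>\<sigma> \<tau>. \<tau> \<in> T \<Longrightarrow> prefix \<sigma> \<tau> \<Longrightarrow> \<sigma> \<in> T"
    "\<And>\<sigma>. \<sigma> \<in> T \<Longrightarrow> \<exists>\<tau>. prefix \<sigma> \<tau> \<and> infinite {i. \<tau> @ [i] \<in> T}"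
  shows "miller_tree T"
  unfolding miller_tree_def
proof (intro conjI allI impI ballI assms(1))
  fix \<sigma> assume "\<sigma> \<in> T"
  then obtain \<tau> where \<tau>: "prefix \<sigma> \<tau>" "infinite {i. \<tau> @ [i] \<in> T}" using assms(3) by blast
  then obtain i where "\<tau> @ [i] \<in> T" using not_finite_existsD by blast
  then have "\<tau> \<in> T" by (rule assms(2)) simp
  with \<tau> show "\<exists>\<rho>. \<sigma> @ \<rho> \<in> T \<and> infinite {i. \<sigma> @ \<rho> @ [i] \<in> T}" by (auto elim!: prefixE)
qed (rule assms(2), auto)

section \<open>Cones of a Miller tree\<close>

definition comparable :: "'a list \<Rightarrow> 'a list \<Rightarrow> bool" where
  "comparable \<sigma> \<tau> \<longleftrightarrow> prefix \<sigma> \<tau> \<or> prefix \<tau> \<sigma>"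

lemma comparable_prefix: "comparable \<sigma> \<tau> \<Longrightarrow> prefix \<rho> \<sigma> \<Longrightarrow> comparable \<rho> \<tau>"
  unfolding comparable_def by (metis prefix_order.trans prefix_same_cases)

lemma comparable_sym: "comparable \<sigma> \<tau> \<Longrightarrow> comparable \<tau> \<sigma>"
  unfolding comparable_def by blast

lemma comparable_snoc: "prefix (\<sigma> @ [i]) \<rho> \<Longrightarrow> comparable \<rho> (\<sigma> @ [j]) \<Longrightarrow> i = j"
  using comparable_prefix[of \<rho> "\<sigma> @ [j]" "\<sigma> @ [i]"] by (auto simp: comparable_def)

text \<open>The part of \<open>p\<close> that forces the Miller real to extend
  \<open>\<tau>\<close>. For \<open>\<tau>\<close> outside \<open>tree_of p\<close> the set in
  braces is not a Miller tree, hence the hypothesis of \<open>tree_of_cone\<close>.\<close>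

definition cone :: "miller \<Rightarrow> nat list \<Rightarrow> miller" where
  "cone p \<tau> = Miller {\<rho> \<in> tree_of p. comparable \<rho> \<tau>}"

lemma tree_of_cone:
  assumes "\<tau> \<in> tree_of p"
  shows "tree_of (cone p \<tau>) = {\<rho> \<in> tree_of p. comparable \<rho> \<tau>}"
proof -
  have "miller_tree {\<rho> \<in> tree_of p. comparable \<rho> \<tau>}"
  proof (rule miller_treeI)
    show "{\<rho> \<in> tree_of p. comparable \<rho> \<tau>} \<noteq> {}" using assms by (auto simp: comparable_def)
    show "\<sigma> \<in> {\<rho> \<in> tree_of p. comparable \<rho> \<tau>}"
      if "\<rho> \<in> {\<rho> \<in> tree_of p. comparable \<rho> \<tau>}" "prefix \<sigma> \<rho>" for \<sigma> \<rho>
      using that tree_of_prefix comparable_prefix by blast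
  next
    fix \<sigma> assume \<sigma>: "\<sigma> \<in> {\<rho> \<in> tree_of p. comparable \<rho> \<tau>}"
    then obtain \<sigma>' where \<sigma>': "\<sigma>' \<in> tree_of p" "prefix \<sigma> \<sigma>'" "prefix \<tau> \<sigma>'"
      using assms unfolding comparable_def by blast
    then obtain \<rho> where \<rho>: "prefix \<sigma>' \<rho>" "splits p \<rho>" using ex_splits_extension by blast
    have "comparable (\<rho> @ [i]) \<tau>" for i
      unfolding comparable_def using \<rho>(1) \<sigma>'(3) by (meson prefix_order.trans prefixI)
    then show "\<exists>\<rho>. prefix \<sigma> \<rho> \<and> infinite {i. \<rho> @ [i] \<in> {\<rho> \<in> tree_of p. comparable \<rho> \<tau>}}"
      using \<rho>(2) prefix_order.trans[OF \<sigma>'(2) \<rho>(1)] by (intro exI[of _ \<rho>]) (simp add: splits_def)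
  qed
  then show ?thesis by (simp add: cone_def Miller_inverse)
qed

lemma cone_le: "\<tau> \<in> tree_of p \<Longrightarrow> cone p \<tau> \<le> p"
  by (simp add: less_eq_miller_def tree_of_cone)

lemma cone_mono: "q \<le> p \<Longrightarrow> \<tau> \<in> tree_of q \<Longrightarrow> cone q \<tau> \<le> cone p \<tau>"
  unfolding less_eq_miller_def by (subst (1 2) tree_of_cone) auto

lemma splits_le: "splits q \<sigma> \<Longrightarrow> q \<le> p \<Longrightarrow> splits p \<sigma>"
  unfolding splits_def less_eq_miller_def by (erule contrapos_nn, rule finite_subset[rotated]) auto

text \<open>Each condition \<open>p\<close> is treated at one splitting node \<open>S p\<close>: the
  successors are cut down to \<open>B p\<close>, and above \<open>S p @ [i]\<close> the construction
  continues with \<open>F p i\<close>. The nodes chosen along the way generate the tree of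
  \<open>q\<close>. Every splitting node of \<open>q\<close> is one of them, so \<open>P\<close> is
  available there.\<close>

lemma miller_fusion:
  assumes step: "\<And>p \<sigma>. splits p \<sigma> \<Longrightarrow>
    \<exists>B f. infinite B \<and> (\<forall>i\<in>B. \<sigma> @ [i] \<in> tree_of p \<and> f i \<le> cone p (\<sigma> @ [i])) \<and> P \<sigma> B f"
  shows "\<exists>q\<le>p. \<forall>\<sigma>. splits q \<sigma> \<longrightarrow>
    (\<exists>B f. P \<sigma> B f \<and> (\<forall>i. \<sigma> @ [i] \<in> tree_of q \<longrightarrow> i \<in> B \<and> cone q (\<sigma> @ [i]) \<le> f i))"
proof -
  have "\<exists>\<sigma> B f. splits p \<sigma> \<and> infinite B \<and> (\<forall>i\<in>B. \<sigma> @ [i] \<in> tree_of p \<and> f i \<le> cone p (\<sigma> @ [i])) \<and> P \<sigma> B f" for p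
    using ex_splits_extension[OF Nil_in_tree] step by metis
  then obtain S B F where S: "\<And>p. splits p (S p)" and B: "\<And>p. infinite (B p)"
    and F: "\<And>p i. i \<in> B p \<Longrightarrow> S p @ [i] \<in> tree_of p \<and> F p i \<le> cone p (S p @ [i])" and P: "\<And>p. P (S p) (B p) (F p)"
    by metis
  \<comment> \<open>One step of \<open>R\<close> passes to the condition above a kept successor;
    \<open>Q p\<close> is the downward closure of the nodes chosen by conditions reachable from
    \<open>p\<close>.\<close>
  define R where "R = {(p, F p i) | p i. i \<in> B p}"
  define Q where "Q p = {\<tau>. \<exists>p'. (p, p') \<in> R\<^sup>* \<and> prefix \<tau> (S p')}" for p
  have le: "p' \<le> p" if "(p, p') \<in> R\<^sup>*" for p p'
    using that
  proof (induction rule: rtrancl_induct)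
    case (step y z)
    then obtain i where "i \<in> B y" "z = F y i" by (auto simp: R_def)
    then have "z \<le> y" using F cone_le order_trans by metis
    then show ?case using step.IH by order
  qed simp
  have Q_tree: "Q p \<subseteq> tree_of p" for p
    using le splits_in_tree[OF S] tree_of_prefix unfolding Q_def less_eq_miller_def by blast
  have S_Q: "S p \<in> Q p" for p by (auto simp: Q_def)
  have F_comparable: "comparable \<rho> (S p @ [i])" if "i \<in> B p" "\<rho> \<in> tree_of (F p i)" for p i \<rho>
    using F[OF that(1)] that(2) by (auto simp: less_eq_miller_def tree_of_cone)
  \<comment> \<open>A condition below \<open>cone p (S p @ [i])\<close> has at most one successor at
    each proper initial segment of \<open>S p @ [i]\<close>, so its chosen splitting node cannot lie
    there.\<close>
  have S_F: "prefix (S p @ [i]) (S (F p i))" if i: "i \<in> B p" for p i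
  proof (rule ccontr)
    assume np: "\<not> prefix (S p @ [i]) (S (F p i))"
    have "comparable (S (F p i)) (S p @ [i])" by (rule F_comparable[OF i splits_in_tree[OF S]])
    then have pre: "prefix (S (F p i)) (S p)" using np by (auto simp: comparable_def)
    obtain k where k: "prefix (S (F p i) @ [k]) (S p @ [i])"
    proof -
      have "strict_prefix (S (F p i)) (S p @ [i])"
        using pre by (metis prefix_snoc prefix_order.le_less append_self_conv not_Cons_self2 prefix_order.antisym prefixI)
      then obtain k zs where "S p @ [i] = S (F p i) @ k # zs" by (rule strict_prefixE')
      then show ?thesis by (intro that[of k]) (simp add: prefix_def)
    qed
    have "k = j" if "S (F p i) @ [j] \<in> tree_of (F p i)" for j
      by (rule comparable_snoc[OF k]) (rule comparable_sym[OF F_comparable[OF i that]])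
    then have "{j. S (F p i) @ [j] \<in> tree_of (F p i)} \<subseteq> {k}" by blast
    then show False using S[of "F p i"] finite_subset unfolding splits_def by blast
  qed
  have Q_cases: "prefix \<tau> (S p) \<or> (\<exists>i\<in>B p. \<tau> \<in> Q (F p i))" if \<tau>: "\<tau> \<in> Q p" for p \<tau>
  proof -
    obtain p' where p': "(p, p') \<in> R\<^sup>*" "prefix \<tau> (S p')" using \<tau> by (auto simp: Q_def)
    from p'(1) show ?thesis
    proof (cases rule: converse_rtranclE)
      case base
      then show ?thesis using p'(2) by simp
    next
      case (step y)
      then show ?thesis using p'(2) by (auto simp: R_def Q_def)
    qed
  qed
  have Q_miller: "miller_tree (Q p)" for p
  proof (rule miller_treeI)
    show "Q p \<noteq> {}" using S_Q by blast
    show "\<sigma> \<in> Q p" if "\<tau> \<in> Q p" "prefix \<sigma> \<tau>" for \<sigma> \<tau>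
      using that unfolding Q_def by (blast intro: prefix_order.trans)
    fix \<sigma> assume "\<sigma> \<in> Q p"
    then obtain p' where p': "(p, p') \<in> R\<^sup>*" "prefix \<sigma> (S p')" by (auto simp: Q_def)
    have "S p' @ [i] \<in> Q p" if "i \<in> B p'" for i
    proof -
      have "(p, F p' i) \<in> R\<^sup>*" using p'(1) that unfolding R_def by (blast intro: rtrancl_into_rtrancl)
      then show ?thesis using S_F[OF that] unfolding Q_def by blast
    qed
    then have "B p' \<subseteq> {i. S p' @ [i] \<in> Q p}" by blast
    then have "infinite {i. S p' @ [i] \<in> Q p}" using B infinite_super by blast
    then show "\<exists>\<tau>. prefix \<sigma> \<tau> \<and> infinite {i. \<tau> @ [i] \<in> Q p}" using p'(2) by blast
  qed
  have succ: "\<exists>j\<in>B p. \<rho> \<in> Q (F p j) \<and> comparable \<rho> (S p @ [j])"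
    if "\<rho> \<in> Q p" "\<not> prefix \<rho> (S p)" for p \<rho>
    using Q_cases[OF that(1)] that(2) F_comparable Q_tree by blast
  have S_comparable: "comparable \<rho> (S p)" if \<rho>: "\<rho> \<in> Q p" for p \<rho>
  proof (cases "prefix \<rho> (S p)")
    case False
    then obtain j where "comparable \<rho> (S p @ [j])" using succ[OF \<rho> False] by blast
    then show ?thesis by (meson comparable_prefix comparable_sym prefixI)
  qed (simp add: comparable_def)
  \<comment> \<open>What is wanted at a splitting node \<open>\<sigma>\<close>: it was chosen by
    some \<open>p'\<close>, and everything in \<open>Q p\<close> above a successor belongs to the
    construction continued from \<open>F p' i\<close>.\<close>
  define split_at where "split_at \<sigma> p \<longleftrightarrow>
    (\<exists>p'. S p' = \<sigma> \<and> (\<forall>i \<rho>. prefix (\<sigma> @ [i]) \<rho> \<longrightarrow> \<rho> \<in> Q p \<longrightarrow> i \<in> B p' \<and> \<rho> \<in> Q (F p' i)))" for \<sigma> p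
  have split_at_root: "split_at \<sigma> p"
    if \<sigma>: "prefix \<sigma> (S p)" "\<sigma> @ [i] \<in> Q p" "\<sigma> @ [j] \<in> Q p" "i \<noteq> j" for p \<sigma> i j
  proof -
    \<comment> \<open>All nodes of \<open>Q p\<close> are comparable with \<open>S p\<close>, so
      nothing branches strictly below \<open>S p\<close>.\<close>
    have "\<sigma> = S p"
    proof (rule ccontr)
      assume "\<sigma> \<noteq> S p"
      then have "strict_prefix \<sigma> (S p)" using \<sigma>(1) by (simp add: strict_prefix_def)
      then obtain k zs where "S p = \<sigma> @ k # zs" by (rule strict_prefixE')
      then have k: "prefix (\<sigma> @ [k]) (S p)" by (simp add: prefix_def)
      have "k = i" "k = j"
        using comparable_snoc[OF k] S_comparable \<sigma>(2,3) comparable_sym by blast+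
      then show False using \<sigma>(4) by simp
    qed
    moreover have "i \<in> B p \<and> \<rho> \<in> Q (F p i)" if \<rho>: "prefix (S p @ [i]) \<rho>" "\<rho> \<in> Q p" for i \<rho>
    proof -
      have "\<not> prefix \<rho> (S p)" using prefix_length_le[OF \<rho>(1)] prefix_length_le[of \<rho> "S p"] by auto
      then obtain l where l: "l \<in> B p" "\<rho> \<in> Q (F p l)" "comparable \<rho> (S p @ [l])" using succ \<rho>(2) by blast
      have "i = l" by (rule comparable_snoc[OF \<rho>(1) l(3)])
      then show ?thesis using l by simp
    qed
    ultimately show ?thesis unfolding split_at_def by blast
  qed
  have split_at: "split_at \<sigma> p"
    if "(p, p') \<in> R\<^sup>*" "prefix \<sigma> (S p')" "\<sigma> @ [i] \<in> Q p" "\<sigma> @ [j] \<in> Q p" "i \<noteq> j" for p p' \<sigma> i j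
    using that
  proof (induction rule: converse_rtrancl_induct)
    case base
    then show ?case using split_at_root by blast
  next
    case (step p p1)
    then obtain k where k: "k \<in> B p" "p1 = F p k" by (auto simp: R_def)
    show ?case
    proof (cases "prefix \<sigma> (S p)")
      case True
      then show ?thesis using split_at_root step.prems by blast
    next
      case False
      have "\<sigma> \<in> Q p1" using step.hyps(2) step.prems(1) by (auto simp: Q_def)
      then have "comparable \<sigma> (S p @ [k])" using F_comparable[OF k(1)] Q_tree k(2) by blast
      then have \<sigma>: "prefix (S p @ [k]) \<sigma>" using False by (auto simp: comparable_def)
      \<comment> \<open>Since \<open>\<sigma>\<close> extends \<open>S p @ [k]\<close>, everything
        of \<open>Q p\<close> above \<open>\<sigma>\<close> comes from the single continuation
        \<open>p1\<close>.\<close>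
      have Q1: "\<rho> \<in> Q p1" if \<rho>: "\<rho> \<in> Q p" "prefix \<sigma> \<rho>" for \<rho>
      proof -
        have "\<not> prefix \<rho> (S p)" using False \<rho>(2) prefix_order.trans by blast
        then obtain l where l: "l \<in> B p" "\<rho> \<in> Q (F p l)" "comparable \<rho> (S p @ [l])" using succ \<rho>(1) by blast
        have "k = l" by (rule comparable_snoc[OF prefix_order.trans[OF \<sigma> \<rho>(2)] l(3)])
        then show ?thesis using l k by simp
      qed
      then have "split_at \<sigma> p1" using step.IH step.prems by simp
      then obtain p' where p': "S p' = \<sigma>"
        "\<And>i \<rho>. prefix (\<sigma> @ [i]) \<rho> \<Longrightarrow> \<rho> \<in> Q p1 \<Longrightarrow> i \<in> B p' \<and> \<rho> \<in> Q (F p' i)"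
        unfolding split_at_def by blast
      then have "i \<in> B p' \<and> \<rho> \<in> Q (F p' i)" if "prefix (\<sigma> @ [i]) \<rho>" "\<rho> \<in> Q p" for i \<rho>
        using that Q1[of \<rho>] append_prefixD by blast
      then show ?thesis unfolding split_at_def using p'(1) by blast
    qed
  qed
  define q where "q = Miller (Q p)"
  have q: "tree_of q = Q p" using Q_miller by (simp add: q_def Miller_inverse)
  show ?thesis
  proof (intro exI[of _ q] conjI allI impI)
    show "q \<le> p" using Q_tree by (simp add: less_eq_miller_def q)
    fix \<sigma> assume \<sigma>: "splits q \<sigma>"
    then obtain i where i: "\<sigma> @ [i] \<in> Q p"
      using not_finite_existsD unfolding splits_def q by blast
    have "\<not> {l. \<sigma> @ [l] \<in> Q p} \<subseteq> {i}" using \<sigma> finite_subset unfolding splits_def q by blast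
    then obtain j where j: "\<sigma> @ [j] \<in> Q p" "i \<noteq> j" by blast
    obtain p' where p': "(p, p') \<in> R\<^sup>*" "prefix (\<sigma> @ [i]) (S p')" using i by (auto simp: Q_def)
    have "split_at \<sigma> p" using split_at[OF p'(1) append_prefixD[OF p'(2)] i j] .
    then obtain p'' where p'': "S p'' = \<sigma>"
      "\<And>i \<rho>. prefix (\<sigma> @ [i]) \<rho> \<Longrightarrow> \<rho> \<in> Q p \<Longrightarrow> i \<in> B p'' \<and> \<rho> \<in> Q (F p'' i)"
      unfolding split_at_def by blast
    have "i \<in> B p'' \<and> cone q (\<sigma> @ [i]) \<le> F p'' i" if i: "\<sigma> @ [i] \<in> tree_of q" for i
    proof
      show "i \<in> B p''" using p''(2)[of i "\<sigma> @ [i]"] i by (simp add: q)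
      \<comment> \<open>Nodes of the cone above the successor lie in \<open>Q (F p'' i)\<close>;
        those below it are initial segments of a node of \<open>F p'' i\<close>.\<close>
      have "\<sigma> @ [i] \<in> tree_of (F p'' i)" using p''(2)[of i "\<sigma> @ [i]"] i Q_tree by (auto simp: q)
      then show "cone q (\<sigma> @ [i]) \<le> F p'' i"
        using p''(2)[of i] Q_tree tree_of_prefix unfolding less_eq_miller_def tree_of_cone[OF i] q comparable_def by blast
    qed
    then show "\<exists>B f. P \<sigma> B f \<and> (\<forall>i. \<sigma> @ [i] \<in> tree_of q \<longrightarrow> i \<in> B \<and> cone q (\<sigma> @ [i]) \<le> f i)"
      using P[of p''] p''(1) by blast
  qed
qed

text \<open>Induction on \<open>M\<close>. If some \<open>x\<close> has infinitely many restrictions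
  among the strings, keep only those indices and delete \<open>res x i\<close> from
  \<open>J i\<close>, which lowers the bound by one. Any \<open>y \<noteq> x\<close> loses only
  finitely many indices, as its restrictions eventually differ from those of \<open>x\<close>. If
  there is no such \<open>x\<close>, \<open>A\<close> itself works.\<close>

lemma finite_limit_points:
  assumes "infinite A" "\<And>i. i \<in> A \<Longrightarrow> finite (J i) \<and> card (J i) \<le> (M::nat)"
  shows "\<exists>B\<subseteq>A. infinite (B :: nat set) \<and> finite {x. infinite {i \<in> B. res x i \<in> J i}}"
  using assms
proof (induction M arbitrary: A J)
  case 0
  then have "J i = {}" if "i \<in> A" for i using that by fastforce
  then have empty: "{i \<in> A. res x i \<in> J i} = {}" for x by auto
  show ?case using 0(1) by (intro exI[of _ A]) (simp only: empty, simp)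
next
  case (Suc M)
  show ?case
  proof (cases "\<exists>x. infinite {i \<in> A. res x i \<in> J i}")
    case True
    then obtain x where x: "infinite {i \<in> A. res x i \<in> J i}" by blast
    let ?J = "\<lambda>i. J i - {res x i}"
    have "\<exists>B\<subseteq>{i \<in> A. res x i \<in> J i}. infinite B \<and> finite {y. infinite {i \<in> B. res y i \<in> ?J i}}"
      using Suc.prems(2) by (intro Suc.IH[OF x]) (fastforce simp: card_Diff_singleton)
    then obtain B where B: "B \<subseteq> {i \<in> A. res x i \<in> J i}" "infinite B"
      "finite {y. infinite {i \<in> B. res y i \<in> ?J i}}" by blast
    have "{y. infinite {i \<in> B. res y i \<in> J i}} \<subseteq> insert x {y. infinite {i \<in> B. res y i \<in> ?J i}}"
    proof
      fix y assume y: "y \<in> {y. infinite {i \<in> B. res y i \<in> J i}}"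
      show "y \<in> insert x {y. infinite {i \<in> B. res y i \<in> ?J i}}"
      proof (cases "y = x")
        case False
        then obtain a where a: "y a \<noteq> x a" by blast
        have "{i \<in> B. res y i \<in> J i} \<subseteq> {i \<in> B. res y i \<in> ?J i} \<union> {..a}"
          using a by (auto simp: not_le res_eq_res_iff)
        then have "infinite {i \<in> B. res y i \<in> ?J i}"
          using y by (metis (no_types, lifting) finite_UnI finite_atMost finite_subset mem_Collect_eq)
        then show ?thesis by blast
      qed simp
    qed
    then show ?thesis using B by (intro exI[of _ B]) (auto intro: finite_subset)
  next
    case False
    then show ?thesis using Suc.prems(1) by (intro exI[of _ A]) auto
  qed
qed

subsection \<open>The forcing relation\<close>

lemma fNot_iff: "(\<^bold>\<not> \<phi>) p \<longleftrightarrow> (\<forall>q\<le>p. \<not> \<phi> q)"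
  by (simp add: fNot_def)

lemma fAnd_iff: "(\<phi> \<^bold>\<and> \<psi>) p \<longleftrightarrow> \<phi> p \<and> \<psi> p"
  by (simp add: fAnd_def)

lemma fAll_iff: "(\<^bold>\<forall>x. \<Phi> x) p \<longleftrightarrow> (\<forall>x. \<Phi> x p)"
  by (simp add: fAll_def)

lemma fImp_iff: "(\<phi> \<^bold>\<longrightarrow> \<psi>) p \<longleftrightarrow> (\<forall>q\<le>p. \<phi> q \<longrightarrow> (\<exists>r\<le>q. \<psi> r))"
  by (auto simp: fImp_def fNot_def fAnd_def)

lemma fEx_iff: "(\<^bold>\<exists>x. \<Phi> x) p \<longleftrightarrow> (\<forall>q\<le>p. \<exists>r\<le>q. \<exists>x. \<Phi> x r)"
  unfolding fEx_def fNot_def fAll_def by blast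

lemma fEx_witness:
  assumes "(\<^bold>\<exists>x. \<Phi> x) p"
  obtains q x where "q \<le> p" "\<Phi> x q"
  using assms by (auto simp: fEx_iff)

text \<open>The conditions satisfying such a sentence form a regular open set in the topology of
  downward closed sets. Density below a condition can then be dropped, which simplifies the clauses
  of the connectives.\<close>

definition regular :: "'p::order sentence \<Rightarrow> bool" where
  "regular \<phi> \<longleftrightarrow> (\<forall>p. \<phi> p \<longleftrightarrow> (\<forall>q\<le>p. \<exists>r\<le>q. \<phi> r))"

lemma regularD: "regular \<phi> \<Longrightarrow> \<phi> p \<Longrightarrow> q \<le> p \<Longrightarrow> \<phi> q"
  unfolding regular_def by (meson order_trans)

lemma regularI:
  assumes "\<And>p q. \<phi> p \<Longrightarrow> q \<le> p \<Longrightarrow> \<phi> q" "\<And>p. \<forall>q\<le>p. \<exists>r\<le>q. \<phi> r \<Longrightarrow> \<phi> p"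
  shows "regular \<phi>"
  unfolding regular_def using assms by blast

lemma regular_dense: "regular \<phi> \<Longrightarrow> \<forall>q\<le>p. \<exists>r\<le>q. \<phi> r \<Longrightarrow> \<phi> p"
  unfolding regular_def by blast

lemma regular_dense_below: "regular (\<lambda>p. \<forall>q\<le>p. \<exists>r\<le>q. \<phi> r)"
proof (rule regularI)
  fix p assume p: "\<forall>q\<le>p. \<exists>r\<le>q. \<forall>q'\<le>r. \<exists>r'\<le>q'. \<phi> r'"
  show "\<forall>q\<le>p. \<exists>r\<le>q. \<phi> r"
  proof (intro allI impI)
    fix q assume "q \<le> p"
    then obtain r r' where "r \<le> q" "r' \<le> r" "\<phi> r'" using p by blast
    then show "\<exists>r\<le>q. \<phi> r" using order_trans by blast
  qed
qed (blast intro: order_trans)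

lemma regular_elem: "regular (a \<^bold>\<in> A)"
  unfolding fElem_def by (rule regular_dense_below)

lemma regular_not:
  assumes "regular \<phi>"
  shows "regular (\<^bold>\<not> \<phi>)"
proof (rule regularI)
  fix p assume p: "\<forall>q\<le>p. \<exists>r\<le>q. (\<^bold>\<not> \<phi>) r"
  show "(\<^bold>\<not> \<phi>) p"
    unfolding fNot_def
  proof (intro allI impI notI)
    fix q assume "q \<le> p" "\<phi> q"
    then obtain r where "r \<le> q" "(\<^bold>\<not> \<phi>) r" using p by blast
    then show False using regularD[OF assms \<open>\<phi> q\<close>, of r] by (simp add: fNot_iff)
  qed
next
  fix p q assume "(\<^bold>\<not> \<phi>) p" "q \<le> p"
  then show "(\<^bold>\<not> \<phi>) q" unfolding fNot_def by (meson order_trans)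
qed

lemma regular_and:
  assumes "regular \<phi>" "regular \<psi>"
  shows "regular (\<phi> \<^bold>\<and> \<psi>)"
  unfolding fAnd_def
proof (rule regularI)
  fix p assume "\<forall>q\<le>p. \<exists>r\<le>q. \<phi> r \<and> \<psi> r"
  then show "\<phi> p \<and> \<psi> p" by (intro conjI assms[THEN regular_dense]) blast+
qed (auto dest: assms[THEN regularD])

lemma regular_ground: "regular (fGround b)"
  by (rule regularI) (auto simp: fGround_def)

lemma regular_imp: "regular \<phi> \<Longrightarrow> regular \<psi> \<Longrightarrow> regular (\<phi> \<^bold>\<longrightarrow> \<psi>)"
  unfolding fImp_def by (intro regular_not regular_and)

lemma regular_iff: "regular \<phi> \<Longrightarrow> regular \<psi> \<Longrightarrow> regular (\<phi> \<^bold>\<longleftrightarrow> \<psi>)"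
  unfolding fIff_def by (intro regular_and regular_imp)

lemma fImp_regular_iff:
  assumes "regular \<phi>" "regular \<psi>"
  shows "(\<phi> \<^bold>\<longrightarrow> \<psi>) p \<longleftrightarrow> (\<forall>q\<le>p. \<phi> q \<longrightarrow> \<psi> q)"
proof
  assume p: "(\<phi> \<^bold>\<longrightarrow> \<psi>) p"
  show "\<forall>q\<le>p. \<phi> q \<longrightarrow> \<psi> q"
  proof (intro allI impI)
    fix q assume q: "q \<le> p" "\<phi> q"
    have "\<exists>r'\<le>r. \<psi> r'" if "r \<le> q" for r
      using p order_trans[OF that q(1)] regularD[OF assms(1) q(2) that] unfolding fImp_iff by blast
    then show "\<psi> q" using regular_dense[OF assms(2)] by blast
  qed
qed (auto simp: fImp_iff)

lemma fGround_imp_iff: "regular \<phi> \<Longrightarrow> (fGround c \<^bold>\<longrightarrow> \<phi>) p \<longleftrightarrow> (c \<longrightarrow> \<phi> p)"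
  unfolding fImp_regular_iff[OF regular_ground] using regularD[of \<phi> p] by (auto simp: fGround_def)

lemma fIff_regular_iff: "regular \<phi> \<Longrightarrow> regular \<psi> \<Longrightarrow> (\<phi> \<^bold>\<longleftrightarrow> \<psi>) p \<longleftrightarrow> (\<forall>q\<le>p. \<phi> q \<longleftrightarrow> \<psi> q)"
  unfolding fIff_def fAnd_def by (simp add: fImp_regular_iff) blast

section \<open>Names for sets, bits and sums\<close>

lemma fElemI: "(a, s) \<in> A \<Longrightarrow> p \<le> s \<Longrightarrow> (a \<^bold>\<in> A) p"
  unfolding fElem_def using order_trans by blast

lemmas fElem_mono = regularD[OF regular_elem]

text \<open>The canonical name of the set of all \<open>a\<close> with \<open>\<phi> a\<close> in
  the extension; it is correct for regular \<open>\<phi> a\<close>.\<close>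

definition name_of :: "('a \<Rightarrow> 'p sentence) \<Rightarrow> ('a, 'p::order) subset_name" where
  "name_of \<phi> = {(a, p). \<phi> a p}"

lemma fElem_name_of: "regular (\<phi> a) \<Longrightarrow> (a \<^bold>\<in> name_of \<phi>) p \<longleftrightarrow> \<phi> a p"
proof -
  assume reg: "regular (\<phi> a)"
  have "(\<exists>s. (a, s) \<in> name_of \<phi> \<and> r \<le> s) \<longleftrightarrow> \<phi> a r" for r
    using regularD[OF reg] by (auto simp: name_of_def)
  then show ?thesis using reg[unfolded regular_def, rule_format, of p] by (simp add: fElem_def)
qed

definition has_bit :: "nat \<Rightarrow> 'p::order point_name \<Rightarrow> bool \<Rightarrow> 'p sentence" where
  "has_bit a x b = (if b then a \<^bold>\<in> x else \<^bold>\<not> a \<^bold>\<in> x)"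

lemma regular_has_bit: "regular (has_bit a x b)"
  by (auto simp: has_bit_def intro: regular_elem regular_not)

lemma fPrefix_iff: "fPrefix s x p \<longleftrightarrow> (\<forall>i<length s. has_bit i x (s ! i) p)"
proof -
  have "(i \<^bold>\<in> x \<^bold>\<longleftrightarrow> fGround b) q \<longleftrightarrow> has_bit i x b q" for i b q
    unfolding fIff_regular_iff[OF regular_elem regular_ground] has_bit_def
    by (auto simp: fGround_def fNot_def regularD[OF regular_elem])
  then show ?thesis
    unfolding fPrefix_def fAll_def by (simp add: fGround_imp_iff regular_iff regular_elem regular_ground)
qed

lemma fPrefix_mono: "fPrefix s x p \<Longrightarrow> q \<le> p \<Longrightarrow> fPrefix s x q"
  unfolding fPrefix_iff using regularD[OF regular_has_bit] by blast

lemma fPrefix_consistent: "fPrefix s x p \<Longrightarrow> fPrefix t x p \<Longrightarrow> i < length s \<Longrightarrow> i < length t \<Longrightarrow> s ! i = t ! i"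
  unfolding fPrefix_iff has_bit_def by (metis (mono_tags, lifting) fNot_iff order_refl)

lemma fEq_iff: "fEq x y p \<longleftrightarrow> (\<forall>n. \<forall>q\<le>p. (n \<^bold>\<in> x) q \<longleftrightarrow> (n \<^bold>\<in> y) q)"
  by (simp add: fEq_def fAll_def fIff_regular_iff regular_elem)

lemma fEq_refl: "fEq x x p"
  by (simp add: fEq_iff)

lemma fPrefix_cong: "fEq x y p \<Longrightarrow> fPrefix s x p \<longleftrightarrow> fPrefix s y p"
  by (auto simp: fPrefix_iff has_bit_def fEq_iff fNot_iff)

lemma fMemI: "(y, p) \<in> Y \<Longrightarrow> q \<le> p \<Longrightarrow> fMem y Y q"
  unfolding fMem_def using fEq_refl order_trans by blast

lemma fMem_check_set: "x \<in> X \<Longrightarrow> fMem (check_point x) (check_set X) p"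
  by (rule fMemI[of _ p]) (auto simp: check_set_def)

lemma fElem_check_point: "(n \<^bold>\<in> check_point x) p \<longleftrightarrow> x n"
  by (auto simp: fElem_def check_point_def)

text \<open>\<open>has_bit n y (\<not> x n)\<close> says that bit \<open>n\<close> of the sum modulo
  2 is 1.\<close>

definition name_add :: "(nat \<Rightarrow> bool) \<Rightarrow> 'p::order point_name \<Rightarrow> 'p point_name" where
  "name_add x y = name_of (\<lambda>n. has_bit n y (\<not> x n))"

lemma fNot_fNot: "regular \<phi> \<Longrightarrow> (\<^bold>\<not> \<^bold>\<not> \<phi>) p \<longleftrightarrow> \<phi> p"
  unfolding fNot_def regular_def by blast

lemma has_bit_name_add: "has_bit n (name_add x y) b p \<longleftrightarrow> has_bit n y (b \<noteq> x n) p"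
proof -
  have *: "(n \<^bold>\<in> name_add x y) p \<longleftrightarrow> has_bit n y (\<not> x n) p" for p
    unfolding name_add_def by (rule fElem_name_of) (rule regular_has_bit)
  show ?thesis
    using fNot_fNot[OF regular_elem, of n y p]
    by (cases b; cases "x n") (simp_all add: has_bit_def[of n "name_add x y"] fNot_def[of "n \<^bold>\<in> name_add x y"] * has_bit_def fNot_def)
qed

lemma fIsSum_name_add: "fIsSum y (check_point x) (name_add x y) p"
proof -
  have "(\<^bold>\<not> (n \<^bold>\<in> check_point x \<^bold>\<longleftrightarrow> n \<^bold>\<in> name_add x y)) q \<longleftrightarrow> (n \<^bold>\<in> y) q" for n q
  proof -
    have "(n \<^bold>\<in> check_point x \<^bold>\<longleftrightarrow> n \<^bold>\<in> name_add x y) r \<longleftrightarrow> (\<^bold>\<not> n \<^bold>\<in> y) r" for r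
    proof -
      have "(n \<^bold>\<in> check_point x \<^bold>\<longleftrightarrow> n \<^bold>\<in> name_add x y) r \<longleftrightarrow> has_bit n (name_add x y) (x n) r"
        unfolding fIff_regular_iff[OF regular_elem regular_elem] fElem_check_point has_bit_def
        by (auto simp: fNot_def regularD[OF regular_elem])
      then show ?thesis by (simp add: has_bit_name_add) (simp add: has_bit_def)
    qed
    then show ?thesis using fNot_fNot[OF regular_elem, of n y q] by (simp add: fNot_def)
  qed
  then show ?thesis
    unfolding fIsSum_def fAll_def by (simp add: fIff_regular_iff regular_elem regular_not regular_iff)
qed

text \<open>Since \<open>z\<close> is the sum of \<open>x\<close> and \<open>name_add x z\<close>,
  placing the latter in \<open>N\<close> suffices.\<close>

lemma fInSumset_name_add:
  assumes "x \<in> X" "(name_add x z, p) \<in> N"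
  shows "fInSumset (check_set X) N z p"
  unfolding fInSumset_def fEx_iff fAnd_def
proof (intro allI impI)
  fix q assume q: "q \<le> p"
  have "fMem (check_point x) (check_set X) r \<and> fMem (name_add x z) N r \<and> fIsSum z (check_point x) (name_add x z) r" if "r \<le> q" for r
    using fMem_check_set[OF assms(1)] fMemI[OF assms(2) order_trans[OF that q]] fIsSum_name_add by blast
  then have "\<forall>q'\<le>q. \<exists>r\<le>q'. \<exists>y. fMem (check_point x) (check_set X) r \<and> fMem y N r \<and> fIsSum z (check_point x) y r"
    by blast
  then show "\<exists>r\<le>q. \<exists>x. \<forall>q\<le>r. \<exists>r\<le>q. \<exists>y. fMem x (check_set X) r \<and> fMem y N r \<and> fIsSum z x y r"
    by blast
qed

section \<open>Nullity and dependent choice in the extension\<close>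

lemma dense_decide_finite:
  assumes "finite F" "\<And>s r r'. P s r \<Longrightarrow> r' \<le> r \<Longrightarrow> P s r'"
    and "\<And>s q. s \<in> F \<Longrightarrow> q \<le> p \<Longrightarrow> \<exists>r\<le>q. P s r"
  shows "\<exists>r\<le>(p::'p::order). \<forall>s\<in>F. P s r"
  using assms(1,3)
proof (induction F)
  case (insert s F)
  then obtain r where r: "r \<le> p" "\<forall>s\<in>F. P s r" by blast
  then obtain r' where "r' \<le> r" "P s r'" using insert.prems by blast
  with r assms(2) show ?case by (intro exI[of _ r']) (auto intro: order_trans)
qed auto

definition forces_subset :: "'a set \<Rightarrow> ('a, 'p::order) subset_name \<Rightarrow> 'p sentence" where
  "forces_subset F U p \<longleftrightarrow> (\<forall>s\<in>F. (s \<^bold>\<in> U) p)"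

lemma forces_subset_mono: "forces_subset F U p \<Longrightarrow> q \<le> p \<Longrightarrow> forces_subset F U q"
  unfolding forces_subset_def by (meson fElem_mono)

text \<open>\<open>A\<close> is arbitrary, so the covering clause stays a density statement: some
  condition below \<open>r\<close> finds a string of \<open>U\<close> that \<open>x\<close>
  extends.\<close>

lemma fNull_iff:
  "fNull A p \<longleftrightarrow> (\<forall>k. \<forall>p'\<le>p. \<exists>q\<le>p'. \<exists>U.
     (\<forall>r\<le>q. \<forall>F. finite F \<longrightarrow> forces_subset F U r \<longrightarrow> (\<Sum>s\<in>F. (1/2::real) ^ length s) \<le> (1/2) ^ k) \<and>
     (\<forall>x. \<forall>r\<le>q. A x r \<longrightarrow> (\<exists>r'\<le>r. \<exists>s. (s \<^bold>\<in> U) r' \<and> fPrefix s x r')))"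
proof -
  have 1: "(\<^bold>\<forall>s. fGround (s \<in> F) \<^bold>\<longrightarrow> s \<^bold>\<in> U) q \<longleftrightarrow> forces_subset F U q" for F :: "bool list set" and U :: "(bool list, 'a) subset_name" and q
    by (auto simp: fAll_def fGround_imp_iff regular_elem forces_subset_def)
  have 2: "(\<^bold>\<forall>F. fGround (finite F) \<^bold>\<and> (\<^bold>\<forall>s. fGround (s \<in> F) \<^bold>\<longrightarrow> s \<^bold>\<in> U) \<^bold>\<longrightarrow> fGround (c F)) q \<longleftrightarrow>
      (\<forall>r\<le>q. \<forall>F. finite F \<longrightarrow> forces_subset F U r \<longrightarrow> c F)" for U :: "(bool list, 'a) subset_name" and c q
    unfolding fAll_iff[of "\<Phi> :: bool list set \<Rightarrow> 'a sentence" for \<Phi>] fImp_iff fAnd_iff 1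
    by (auto simp: fGround_def)
  have 3: "(\<exists>r'\<le>r. (\<^bold>\<exists>s. s \<^bold>\<in> U \<^bold>\<and> fPrefix s x) r') \<longleftrightarrow> (\<exists>r'\<le>r. \<exists>s. (s \<^bold>\<in> U) r' \<and> fPrefix s x r')"
    for U :: "(bool list, 'a) subset_name" and x r
  proof
    assume "\<exists>r'\<le>r. \<exists>s. (s \<^bold>\<in> U) r' \<and> fPrefix s x r'"
    then obtain r' s where "r' \<le> r" "(s \<^bold>\<in> U) r'" "fPrefix s x r'" by blast
    then have "(\<^bold>\<exists>s. s \<^bold>\<in> U \<^bold>\<and> fPrefix s x) r'"
      unfolding fEx_iff fAnd_def by (meson fElem_mono fPrefix_mono order_refl)
    then show "\<exists>r'\<le>r. (\<^bold>\<exists>s. s \<^bold>\<in> U \<^bold>\<and> fPrefix s x) r'" using \<open>r' \<le> r\<close> by blast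
  next
    assume "\<exists>r'\<le>r. (\<^bold>\<exists>s. s \<^bold>\<in> U \<^bold>\<and> fPrefix s x) r'"
    then obtain r' where "r' \<le> r" "(\<^bold>\<exists>s. s \<^bold>\<in> U \<^bold>\<and> fPrefix s x) r'" by blast
    then show "\<exists>r'\<le>r. \<exists>s. (s \<^bold>\<in> U) r' \<and> fPrefix s x r'"
      by (elim fEx_witness) (auto simp: fAnd_def intro: order_trans)
  qed
  show ?thesis
    by (simp only: fNull_def fAll_iff[of "\<Phi> :: nat \<Rightarrow> 'a sentence" for \<Phi>] fAll_iff[of "\<Phi> :: 'a point_name \<Rightarrow> 'a sentence" for \<Phi>]
      fEx_iff[of "\<Phi> :: (bool list, 'a) subset_name \<Rightarrow> 'a sentence" for \<Phi>] fAnd_iff 2 fImp_iff[of "A _"] 3)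
qed

text \<open>The recursion picks at each step the least possible extension, so that the chosen strings agree
  on compatible conditions.\<close>

lemma name_of_dependent_choice:
  fixes \<phi> :: "'p::order \<Rightarrow> bool list \<Rightarrow> bool list \<Rightarrow> bool"
  assumes mono: "\<And>r r' s t. \<phi> r s t \<Longrightarrow> r' \<le> r \<Longrightarrow> \<phi> r' s t"
    and ext: "\<And>r s t. \<phi> r s t \<Longrightarrow> strict_prefix s t"
    and total: "\<And>r t. r \<le> r0 \<Longrightarrow> t = [] \<or> (\<exists>s. \<phi> r s t) \<Longrightarrow> \<exists>r'\<le>r. \<exists>t'. \<phi> r' t t'"
  shows "\<exists>z. \<forall>r\<le>r0. \<forall>j. \<exists>r'\<le>r. \<exists>s t. j \<le> length s \<and> \<phi> r' s t \<and> fPrefix t z r'"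
proof -
  \<comment> \<open>\<open>D j r t\<close> says that \<open>r\<close> decides \<open>t\<close> to be
    the \<open>j\<close>-th string. Minimality of its code ranges over all conditions below
    \<open>r\<close>, which makes \<open>D\<close> persist to stronger conditions and gives
    uniqueness at each condition.\<close>
  define D where "D = rec_nat (\<lambda>r t. t = []) (\<lambda>j Dj r t. \<exists>s. Dj r s \<and> \<phi> r s t \<and> (\<forall>r'\<le>r. \<forall>t'. \<phi> r' s t' \<longrightarrow> to_nat t \<le> to_nat t'))"
  have D0: "D 0 r t \<longleftrightarrow> t = []" for r t by (simp add: D_def)
  have DS: "D (Suc j) r t \<longleftrightarrow> (\<exists>s. D j r s \<and> \<phi> r s t \<and> (\<forall>r'\<le>r. \<forall>t'. \<phi> r' s t' \<longrightarrow> to_nat t \<le> to_nat t'))" for j r t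
    by (simp add: D_def)
  have D_mono: "D j r t \<Longrightarrow> r' \<le> r \<Longrightarrow> D j r' t" for j r r' t
  proof (induction j arbitrary: t)
    case (Suc j)
    then show ?case unfolding DS using mono by (meson order_trans)
  qed (simp add: D0)
  have D_unique: "D j r t \<Longrightarrow> D j r t' \<Longrightarrow> t = t'" for j r t t'
  proof (induction j arbitrary: t t')
    case (Suc j)
    obtain s where s: "D j r s" "\<phi> r s t" "\<And>u. \<phi> r s u \<Longrightarrow> to_nat t \<le> to_nat u" using Suc.prems(1) unfolding DS by blast
    obtain s' where s': "D j r s'" "\<phi> r s' t'" "\<And>u. \<phi> r s' u \<Longrightarrow> to_nat t' \<le> to_nat u" using Suc.prems(2) unfolding DS by blast
    have "s = s'" using Suc.IH s(1) s'(1) by blast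
    then have "to_nat t = to_nat t'" using s(2,3) s'(2,3) by (intro antisym) blast+
    then show ?case by simp
  qed (simp add: D0)
  have D_prefix: "D j r t \<Longrightarrow> \<exists>s. D i r s \<and> prefix s t" if "i \<le> j" for i j r t
    using that
  proof (induction j arbitrary: t)
    case (Suc j)
    show ?case
    proof (cases "i = Suc j")
      case False
      obtain s where s: "D j r s" "\<phi> r s t" using Suc.prems(1) unfolding DS by blast
      then show ?thesis using Suc.IH[OF s(1)] Suc.prems(2) False ext[OF s(2)]
        by (meson le_Suc_eq prefix_order.less_imp_le prefix_order.trans)
    qed (use Suc.prems in auto)
  qed auto
  have D_comparable: "comparable t t'" if "D i r t" "D j r t'" for i j r t t'
    using D_prefix[of i j r t'] D_prefix[of j i r t] D_unique that unfolding comparable_def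
    by (metis nle_le)
  have D_inv: "D j r t \<Longrightarrow> t = [] \<or> (\<exists>s. \<phi> r s t)" for j r t
    by (cases j) (auto simp: D0 DS)
  have D_ex: "\<exists>r'\<le>r. \<exists>t. D j r' t" if "r \<le> r0" for j r
  proof (induction j)
    case 0
    then show ?case using D0 by blast
  next
    case (Suc j)
    then obtain r1 s where r1: "r1 \<le> r" "D j r1 s" by blast
    \<comment> \<open>The codes of extensions of \<open>s\<close> available anywhere below
      \<open>r1\<close>; a condition attaining the least one decides the next string.\<close>
    define T where "T = {to_nat t | t r'. r' \<le> r1 \<and> \<phi> r' s t}"
    have "\<exists>r'\<le>r1. \<exists>t. \<phi> r' s t" using total[OF _ D_inv[OF r1(2)]] order_trans[OF r1(1) that] by blast
    then obtain n0 where "n0 \<in> T" unfolding T_def by blast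
    define m where "m = (LEAST n. n \<in> T)"
    have "m \<in> T" unfolding m_def by (rule LeastI) fact
    then obtain t r2 where t: "r2 \<le> r1" "\<phi> r2 s t" "to_nat t = m" unfolding T_def by blast
    have "to_nat t \<le> to_nat t'" if "r' \<le> r2" "\<phi> r' s t'" for r' t'
    proof -
      have "to_nat t' \<in> T" using that order_trans[OF that(1) t(1)] unfolding T_def by blast
      then show ?thesis unfolding t(3) m_def by (rule Least_le)
    qed
    then have "D (Suc j) r2 t" unfolding DS using D_mono[OF r1(2) t(1)] t(2) by blast
    then show ?case using order_trans[OF t(1) r1(1)] by blast
  qed
  have D_length: "D j r t \<Longrightarrow> j \<le> length t" for j r t
  proof (induction j arbitrary: t)
    case (Suc j)
    then obtain s where "D j r s" "\<phi> r s t" unfolding DS by blast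
    then show ?case using Suc.IH[of s] ext prefix_length_less by fastforce
  qed simp
  \<comment> \<open>The union of all decided strings. Strings decided by compatible conditions are
    comparable, so a bit that is 0 in a decided string is never set by a compatible
    condition.\<close>
  define z where "z = {(a, r). \<exists>j t. D j r t \<and> a < length t \<and> t ! a}"
  have z: "fPrefix t z r" if t: "D j r t" for j r t
    unfolding fPrefix_iff
  proof (intro allI impI)
    fix a assume a: "a < length t"
    show "has_bit a z (t ! a) r"
    proof (cases "t ! a")
      case True
      then have "(a, r) \<in> z" using t a unfolding z_def by blast
      then show ?thesis using True by (simp add: has_bit_def fElemI)
    next
      case False
      have "\<not> (a \<^bold>\<in> z) q" if q: "q \<le> r" for q
      proof
        assume "(a \<^bold>\<in> z) q"
        then obtain q' w where q': "q' \<le> q" "(a, w) \<in> z" "q' \<le> w" unfolding fElem_def by blast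
        then obtain i t' where t': "D i w t'" "a < length t'" "t' ! a" unfolding z_def by blast
        have "comparable t t'"
          using D_comparable D_mono[OF t order_trans[OF q'(1) q]] D_mono[OF t'(1) q'(3)] by blast
        then show False using t' a False by (auto simp: comparable_def prefix_def nth_append)
      qed
      then show ?thesis using False by (simp add: has_bit_def fNot_def)
    qed
  qed
  have "\<exists>r'\<le>r. \<exists>s t. j \<le> length s \<and> \<phi> r' s t \<and> fPrefix t z r'" if r: "r \<le> r0" for r j
  proof -
    \<comment> \<open>Stage \<open>Suc j\<close>, so that the last extension starts from the string
      \<open>s\<close> of stage \<open>j\<close>, whose length is at least \<open>j\<close>.\<close>
    obtain r' t where r': "r' \<le> r" "D (Suc j) r' t" using D_ex[OF r] by blast
    then obtain s where "D j r' s" "\<phi> r' s t" unfolding DS by blast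
    then show ?thesis using r' z D_length by blast
  qed
  then show ?thesis by blast
qed

subsection \<open>The Miller real and the null set\<close>

text \<open>Every node of a Miller tree has longer extensions, so this says that \<open>p\<close>
  forces the Miller real to take the value \<open>i\<close> at \<open>n\<close>.\<close>

definition decides :: "miller \<Rightarrow> nat \<Rightarrow> nat \<Rightarrow> bool" where
  "decides p n i \<longleftrightarrow> (\<forall>\<tau>\<in>tree_of p. n < length \<tau> \<longrightarrow> \<tau> ! n = i)"

lemma decides_mono: "decides p n i \<Longrightarrow> q \<le> p \<Longrightarrow> decides q n i"
  by (auto simp: decides_def less_eq_miller_def)

lemma decides_unique:
  assumes "decides p n i" "decides p n j"
  shows "i = j"
proof -
  obtain \<tau> where "splits p \<tau>" "Suc n \<le> length \<tau>" using ex_splits_long by blast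
  then have "\<tau> \<in> tree_of p" "n < length \<tau>" using splits_in_tree by auto
  then show ?thesis using assms unfolding decides_def by metis
qed

lemma decides_cone:
  assumes "\<sigma> @ [i] \<in> tree_of p"
  shows "decides (cone p (\<sigma> @ [i])) (length \<sigma>) i"
  unfolding decides_def tree_of_cone[OF assms] comparable_def
proof (intro ballI impI)
  fix \<tau> assume "\<tau> \<in> {\<rho> \<in> tree_of p. prefix \<rho> (\<sigma> @ [i]) \<or> prefix (\<sigma> @ [i]) \<rho>}" and l: "length \<sigma> < length \<tau>"
  then consider "prefix \<tau> (\<sigma> @ [i])" | "prefix (\<sigma> @ [i]) \<tau>" by blast
  then show "\<tau> ! length \<sigma> = i"
  proof cases
    case 1
    then have "\<tau> = \<sigma> @ [i]" using l prefix_length_le[of \<tau> \<sigma>] by (auto simp: prefix_snoc)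
    then show ?thesis by simp
  next
    case 2
    then show ?thesis by (auto simp: prefix_def)
  qed
qed

text \<open>With \<open>g\<close> the Miller real: \<open>y\<close> lies in
  \<open>Cset n (g n)\<close> for infinitely many \<open>n\<close>, witnessed by a finite prefix of
  \<open>y\<close>.\<close>

definition in_limsup :: "miller point_name \<Rightarrow> miller sentence" where
  "in_limsup y p \<longleftrightarrow> (\<forall>m. \<forall>q\<le>p. \<exists>r\<le>q. \<exists>n\<ge>m. \<exists>i. \<exists>t\<in>Cstrings n i. decides r n i \<and> fPrefix t y r)"

definition limsup_name :: "miller set_name" where
  "limsup_name = {(y, p). in_limsup y p}"

lemma sum_half_powers_le:
  assumes "finite T" "T \<subseteq> {k<..}"
  shows "(\<Sum>n\<in>T. (1/2::real) ^ n) \<le> (1/2) ^ k"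
proof -
  have *: "(\<Sum>n\<in>{k<..k + h}. (1/2::real) ^ n) = (1/2) ^ k - (1/2) ^ (k + h)" for h
  proof (induction h)
    case (Suc h)
    have "{k<..k + Suc h} = insert (k + Suc h) {k<..k + h}" by auto
    then show ?case using Suc by simp
  qed simp
  obtain h where "\<forall>n\<in>T. n \<le> h" using assms(1) finite_nat_set_iff_bounded_le by blast
  then have "T \<subseteq> {k<..k + h}" using assms(2) by (force intro: trans_le_add2)
  then have "(\<Sum>n\<in>T. (1/2::real) ^ n) \<le> (\<Sum>n\<in>{k<..k + h}. (1/2::real) ^ n)" by (intro sum_mono2) auto
  also have "\<dots> \<le> (1/2) ^ k" unfolding * by simp
  finally show ?thesis .
qed

text \<open>The sets \<open>Cset n (g n)\<close> with \<open>n > k\<close> cover the limsup, and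
  their measures add up to at most the tail \<open>(1/2) ^ k\<close> of the geometric
  series.\<close>

lemma fNull_limsup_name: "fNull (\<lambda>x. fMem x limsup_name) p"
  unfolding fNull_iff
proof (intro allI impI)
  fix k p' assume "p' \<le> p"
  define U where "U = {(s, r). \<exists>n>k. \<exists>i. decides r n i \<and> s \<in> Cstrings n i}"
  have sum: "(\<Sum>s\<in>F. (1/2::real) ^ length s) \<le> (1/2) ^ k" if F: "finite F" "forces_subset F U r" for F r
  proof -
    \<comment> \<open>One condition decides, for every \<open>s\<close> in \<open>F\<close>, a pair
      \<open>n\<close>, \<open>i\<close> that puts it into \<open>U\<close>. As \<open>n\<close>
      determines \<open>i\<close>, the strings of \<open>F\<close> sharing \<open>n\<close> lie in a
      single \<open>Cstrings n i\<close>.\<close>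
    have "\<exists>r'\<le>r. \<forall>s\<in>F. \<exists>n i. k < n \<and> decides r' n i \<and> s \<in> Cstrings n i"
    proof (rule dense_decide_finite[OF F(1)])
      fix s q assume "s \<in> F" "q \<le> r"
      then have "(s \<^bold>\<in> U) q" using F(2) fElem_mono unfolding forces_subset_def by meson
      then obtain q' w where "q' \<le> q" "(s, w) \<in> U" "q' \<le> w" unfolding fElem_def by blast
      then show "\<exists>r'\<le>q. \<exists>n i. k < n \<and> decides r' n i \<and> s \<in> Cstrings n i"
        unfolding U_def using decides_mono by blast
    qed (use decides_mono in meson)
    then obtain r' where "\<forall>s\<in>F. \<exists>n i. k < n \<and> decides r' n i \<and> s \<in> Cstrings n i" by blast
    then obtain N I where NI: "\<And>s. s \<in> F \<Longrightarrow> k < N s \<and> decides r' (N s) (I s) \<and> s \<in> Cstrings (N s) (I s)"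
      by metis
    have "(\<Sum>s\<in>F. (1/2::real) ^ length s) = (\<Sum>n\<in>N ` F. \<Sum>s\<in>{s \<in> F. N s = n}. (1/2::real) ^ length s)"
      using F(1) by (rule sum.image_gen)
    also have "\<dots> \<le> (\<Sum>n\<in>N ` F. (1/2) ^ n)"
    proof (rule sum_mono)
      fix n assume "n \<in> N ` F"
      then obtain s where s: "s \<in> F" "n = N s" by blast
      have "{s \<in> F. N s = n} \<subseteq> Cstrings n (I s)"
      proof
        fix t assume "t \<in> {s \<in> F. N s = n}"
        then have "decides r' n (I t)" "t \<in> Cstrings n (I t)" using NI[of t] by auto
        then show "t \<in> Cstrings n (I s)" using decides_unique NI[OF s(1)] s(2) by metis
      qed
      then have "(\<Sum>s\<in>{s \<in> F. N s = n}. (1/2::real) ^ length s) \<le> (\<Sum>s\<in>Cstrings n (I s). (1/2::real) ^ length s)"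
        by (intro sum_mono2 finite_Cstrings) auto
      then show "(\<Sum>s\<in>{s \<in> F. N s = n}. (1/2::real) ^ length s) \<le> (1/2) ^ n"
        using sum_Cstrings order_trans by blast
    qed
    also have "\<dots> \<le> (1/2) ^ k" using F(1) NI by (intro sum_half_powers_le) auto
    finally show ?thesis .
  qed
  have cover: "\<exists>r'\<le>r. \<exists>s. (s \<^bold>\<in> U) r' \<and> fPrefix s x r'" if x: "fMem x limsup_name r" for x r
  proof -
    obtain q y w where q: "q \<le> r" "in_limsup y w" "q \<le> w" "fEq x y q"
      using x unfolding fMem_def limsup_name_def by blast
    then obtain r' n i t where r': "r' \<le> q" "Suc k \<le> n" "t \<in> Cstrings n i" "decides r' n i" "fPrefix t y r'"
      unfolding in_limsup_def by blast
    have "fEq x y r'" using q(4) r'(1) order_trans unfolding fEq_iff by blast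
    then have "fPrefix t x r'" using r'(5) fPrefix_cong by blast
    moreover have tU: "(t, r') \<in> U" using r'(2-4) Suc_le_eq unfolding U_def by blast
    moreover have "(t \<^bold>\<in> U) r'" by (rule fElemI[OF tU order_refl])
    ultimately show ?thesis using order_trans[OF r'(1) q(1)] by blast
  qed
  show "\<exists>q\<le>p'. \<exists>U. (\<forall>r\<le>q. \<forall>F. finite F \<longrightarrow> forces_subset F U r \<longrightarrow> (\<Sum>s\<in>F. (1/2::real) ^ length s) \<le> (1/2) ^ k) \<and>
     (\<forall>x. \<forall>r\<le>q. fMem x limsup_name r \<longrightarrow> (\<exists>r'\<le>r. \<exists>s. (s \<^bold>\<in> U) r' \<and> fPrefix s x r'))"
    using sum cover by (intro exI[of _ p'] conjI exI[of _ U] order_refl) blast+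
qed

subsection \<open>Measure outside a named open set\<close>

text \<open>\<open>p\<close> forces the part of \<open>A\<close> outside the open set named by
  \<open>U\<close> to have measure at least \<open>\<delta>\<close>. By continuity from above it is
  enough, for measurable \<open>A\<close>, to remove finitely many cylinders at a time.\<close>

definition bounded_outside :: "(bool list, 'p::order) subset_name \<Rightarrow> 'p \<Rightarrow> (nat \<Rightarrow> bool) set \<Rightarrow> real \<Rightarrow> bool" where
  "bounded_outside U p A \<delta> \<longleftrightarrow> (\<forall>q\<le>p. \<forall>F. finite F \<longrightarrow> forces_subset F U q \<longrightarrow> \<delta> \<le> measure cantor_measure (A - (\<Union>s\<in>F. cyl s)))"

text \<open>\<open>p\<close> forces \<open>A\<close> to be almost contained in the open set: no
  stronger condition forces a positive lower bound on what is left.\<close>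

definition null_outside :: "(bool list, 'p::order) subset_name \<Rightarrow> 'p \<Rightarrow> (nat \<Rightarrow> bool) set \<Rightarrow> bool" where
  "null_outside U p A \<longleftrightarrow> (\<forall>\<delta>>0. \<forall>q\<le>p. \<not> bounded_outside U q A \<delta>)"

lemma bounded_outside_mono: "bounded_outside U p A \<delta> \<Longrightarrow> q \<le> p \<Longrightarrow> bounded_outside U q A \<delta>"
  unfolding bounded_outside_def using order_trans by blast

lemma null_outside_mono: "null_outside U p A \<Longrightarrow> q \<le> p \<Longrightarrow> null_outside U q A"
  unfolding null_outside_def using order_trans by blast

lemma null_outsideE:
  assumes "null_outside U p A" "0 < \<delta>"
  obtains q F where "q \<le> p" "finite F" "forces_subset F U q" "measure cantor_measure (A - (\<Union>s\<in>F. cyl s)) < \<delta>"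
  using assms unfolding null_outside_def bounded_outside_def by (metis not_le order_refl)

lemma sets_UN_cyl: "finite F \<Longrightarrow> (\<Union>s\<in>F. cyl s) \<in> sets cantor_measure"
  by auto

text \<open>Some stronger condition puts a finite \<open>F\<close> into \<open>U\<close> that covers
  \<open>B\<close> up to measure \<open>e\<close>. What \<open>A\<close> has outside
  \<open>F\<close> then lies outside \<open>B\<close>, up to measure \<open>e\<close>.\<close>

lemma bounded_outside_le:
  assumes "bounded_outside U p A \<delta>" "null_outside U p B" "A \<in> sets cantor_measure" "B \<in> sets cantor_measure"
  shows "\<delta> \<le> measure cantor_measure (A - B)"
proof (rule field_le_epsilon)
  fix e :: real assume "0 < e"
  then obtain q F where F: "q \<le> p" "finite F" "forces_subset F U q" "measure cantor_measure (B - (\<Union>s\<in>F. cyl s)) < e"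
    using null_outsideE[OF assms(2)] by blast
  let ?F = "\<Union>s\<in>F. cyl s"
  have "\<delta> \<le> measure cantor_measure (A - ?F)" using assms(1) F unfolding bounded_outside_def by blast
  also have "\<dots> \<le> measure cantor_measure ((A - B) \<union> (B - ?F))"
    using assms(3,4) sets_UN_cyl[OF F(2)] by (intro cantor.finite_measure_mono) auto
  also have "\<dots> \<le> measure cantor_measure (A - B) + measure cantor_measure (B - ?F)"
    using assms(3,4) sets_UN_cyl[OF F(2)] by (intro measure_Un_le) auto
  finally show "\<delta> \<le> measure cantor_measure (A - B) + e" using F(4) by simp
qed

text \<open>If \<open>A \<union> B\<close> had measure at least \<open>\<delta>\<close> outside, so
  would its remainder after removing any finite \<open>F\<close> forced into \<open>U\<close>.
  Removing the null part \<open>A\<close> from this remainder by \<open>bounded_outside_le\<close>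
  leaves the bound \<open>\<delta>\<close> for \<open>B\<close> alone.\<close>

lemma null_outside_Un:
  assumes "null_outside U p A" "null_outside U p B" "A \<in> sets cantor_measure" "B \<in> sets cantor_measure"
  shows "null_outside U p (A \<union> B)"
  unfolding null_outside_def
proof (intro allI impI notI)
  fix \<delta> :: real and q assume \<delta>: "0 < \<delta>" and q: "q \<le> p" and b: "bounded_outside U q (A \<union> B) \<delta>"
  have "bounded_outside U q B \<delta>"
    unfolding bounded_outside_def
  proof (intro allI impI)
    fix r F assume F: "r \<le> q" "finite F" "forces_subset F U r"
    have "bounded_outside U r (A \<union> B - (\<Union>s\<in>F. cyl s)) \<delta>"
      unfolding bounded_outside_def
    proof (intro allI impI)
      fix r' F' assume F': "r' \<le> r" "finite F'" "forces_subset F' U r'"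
      then have "forces_subset (F \<union> F') U r'" using forces_subset_mono[OF F(3) F'(1)] by (auto simp: forces_subset_def)
      then have "\<delta> \<le> measure cantor_measure (A \<union> B - (\<Union>s\<in>F \<union> F'. cyl s))"
        using b F F' order_trans unfolding bounded_outside_def by (metis finite_UnI)
      moreover have "A \<union> B - (\<Union>s\<in>F \<union> F'. cyl s) = A \<union> B - (\<Union>s\<in>F. cyl s) - (\<Union>s\<in>F'. cyl s)" by blast
      ultimately show "\<delta> \<le> measure cantor_measure (A \<union> B - (\<Union>s\<in>F. cyl s) - (\<Union>s\<in>F'. cyl s))" by simp
    qed
    then have "\<delta> \<le> measure cantor_measure (A \<union> B - (\<Union>s\<in>F. cyl s) - A)"
      using null_outside_mono[OF assms(1) order_trans[OF F(1) q]] assms(3,4) sets_UN_cyl[OF F(2)]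
      by (intro bounded_outside_le) auto
    also have "\<dots> \<le> measure cantor_measure (B - (\<Union>s\<in>F. cyl s))"
      using assms(4) sets_UN_cyl[OF F(2)] by (intro cantor.finite_measure_mono) auto
    finally show "\<delta> \<le> measure cantor_measure (B - (\<Union>s\<in>F. cyl s))" .
  qed
  then show False using assms(2) \<delta> q unfolding null_outside_def by blast
qed

lemma null_outside_empty: "null_outside U p {}"
  unfolding null_outside_def bounded_outside_def forces_subset_def
  by (auto simp: not_le intro!: exI[of _ "{}"])

lemma null_outside_UN:
  assumes "finite I" "\<And>i. i \<in> I \<Longrightarrow> A i \<in> sets cantor_measure" "\<And>i. i \<in> I \<Longrightarrow> null_outside U p (A i)"
  shows "null_outside U p (\<Union>i\<in>I. A i)"
  using assms
proof (induction I)
  case (insert i I)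
  have "(\<Union>i\<in>I. A i) \<in> sets cantor_measure" using insert by (intro sets.finite_UN) auto
  then show ?case using insert null_outside_Un[of U p "A i" "\<Union>i\<in>I. A i"] by simp
qed (simp add: null_outside_empty)

subsection \<open>Few translates are null outside an open set\<close>

definition null_translates :: "(bool list, 'p::order) subset_name \<Rightarrow> 'p \<Rightarrow> nat \<Rightarrow> nat \<Rightarrow> bool list set" where
  "null_translates U p n i = {res x i | x s. length s \<le> n \<and> bounded_outside U p (cyl s) (1 / (real n + 1)) \<and>
     null_outside U p (cyl s \<inter> translate x (Cset n i))}"

lemma null_translates_mono: "q \<le> p \<Longrightarrow> null_translates U p n i \<subseteq> null_translates U q n i"
  unfolding null_translates_def using bounded_outside_mono null_outside_mono by blast

lemma finite_null_translates: "finite (null_translates U p n i)"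
  by (rule finite_subset[OF _ finite_strings(1)[of i]]) (auto simp: null_translates_def)

text \<open>For fixed \<open>s\<close>, the translates by points with distinct restrictions are
  independent, so \<open>k\<close> of them miss a set of measure \<open>(1 - (1/2) ^ n) ^ k\<close>.
  If all are null outside \<open>U\<close> within \<open>s\<close>, this is at least
  \<open>1 / (real n + 1)\<close>, which bounds \<open>k\<close> by \<open>M\<close>. There are
  finitely many \<open>s\<close> of length at most \<open>n\<close>.\<close>

lemma card_null_translates: "\<exists>M. \<forall>U (p::'p::order) i. card (null_translates U p n i) \<le> M"
proof -
  have "\<exists>M. (1 - (1/2::real) ^ n) ^ M < 1 / (real n + 1)"
    by (rule real_arch_pow_inv) auto
  then obtain M where M: "(1 - (1/2::real) ^ n) ^ M < 1 / (real n + 1)" by blast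
  let ?S = "{s::bool list. length s \<le> n}"
  have "card (null_translates U p n i) \<le> card ?S * M" for U and p :: 'p and i
  proof -
    define H where "H s = (\<lambda>x. res x i) ` {x. bounded_outside U p (cyl s) (1 / (real n + 1)) \<and>
      null_outside U p (cyl s \<inter> translate x (Cset n i))}" for s
    have "card (H s) \<le> M" for s
    proof -
      \<comment> \<open>One point for each string of \<open>H s\<close>, so that the restrictions to
        \<open>i\<close> are distinct on \<open>C\<close>.\<close>
      obtain C where C: "C \<subseteq> {x. bounded_outside U p (cyl s) (1 / (real n + 1)) \<and>
          null_outside U p (cyl s \<inter> translate x (Cset n i))}" "H s = (\<lambda>x. res x i) ` C" "inj_on (\<lambda>x. res x i) C"
        using subset_image_inj[THEN iffD1, OF order_refl[of "H s", unfolded H_def]] unfolding H_def by blast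
      have "finite (H s)" by (rule finite_subset[OF _ finite_strings(1)[of i]]) (auto simp: H_def)
      then have fin: "finite C" using C(2,3) finite_imageD by metis
      show ?thesis
      proof (cases "C = {}")
        case False
        then have b: "bounded_outside U p (cyl s) (1 / (real n + 1))" using C(1) by blast
        have "null_outside U p (\<Union>x\<in>C. cyl s \<inter> translate x (Cset n i))"
          using C(1) by (intro null_outside_UN fin) auto
        then have "1 / (real n + 1) \<le> measure cantor_measure (cyl s - (\<Union>x\<in>C. cyl s \<inter> translate x (Cset n i)))"
          using fin by (intro bounded_outside_le[OF b]) auto
        also have "\<dots> \<le> measure cantor_measure (- (\<Union>x\<in>C. translate x (Cset n i)))"
        proof (rule cantor.finite_measure_mono)
          have "(\<Union>x\<in>C. translate x (Cset n i)) \<in> sets cantor_measure" using fin by auto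
          then show "- (\<Union>x\<in>C. translate x (Cset n i)) \<in> sets cantor_measure"
            using sets.compl_sets[of _ cantor_measure] by (simp add: Compl_eq_Diff_UNIV)
        qed blast
        also have "\<dots> = (1 - (1/2) ^ n) ^ card C" by (rule measure_avoid_translates[OF fin C(3)])
        finally have "(1 - (1/2::real) ^ n) ^ M < (1 - (1/2) ^ n) ^ card C" using M by simp
        then have "card C \<le> M"
          using power_decreasing[of M "card C" "1 - (1/2::real) ^ n"] by (fastforce simp: power_le_one)
        then show ?thesis using C(2,3) by (simp add: card_image)
      qed (simp add: C(2))
    qed
    then have "(\<Sum>s\<in>?S. card (H s)) \<le> card ?S * M"
      using sum_bounded_above[of ?S "\<lambda>s. card (H s)" M] by simp
    then have "card (\<Union>s\<in>?S. H s) \<le> card ?S * M"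
      using card_UN_le[OF finite_strings(2), of H n] by linarith
    moreover have "null_translates U p n i = (\<Union>s\<in>?S. H s)" by (auto simp: null_translates_def H_def)
    ultimately show ?thesis by simp
  qed
  then show ?thesis by blast
qed

text \<open>The sets grow as the condition gets stronger and their cardinality is bounded, so a
  condition where it is maximal decides the set.\<close>

lemma stable_null_translates:
  "\<exists>q\<le>p. \<forall>r\<le>q. null_translates U r n i = null_translates U (q::'p::order) n i"
proof -
  obtain M where M: "\<And>q::'p. card (null_translates U q n i) \<le> M" using card_null_translates by blast
  have "\<exists>q. q \<le> p \<and> (\<forall>r. r \<le> p \<longrightarrow> card (null_translates U r n i) \<le> card (null_translates U q n i))"
    by (rule ex_has_greatest_nat[of _ p _ "Suc M"]) (use M in \<open>auto simp: less_Suc_eq_le\<close>)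
  then obtain q where q: "q \<le> p" "\<And>r. r \<le> p \<Longrightarrow> card (null_translates U r n i) \<le> card (null_translates U q n i)"
    by blast
  have "null_translates U r n i = null_translates U q n i" if r: "r \<le> q" for r
    using card_seteq[OF finite_null_translates null_translates_mono[OF r] q(2)[OF order_trans[OF r q(1)]]] by simp
  then show ?thesis using q(1) by blast
qed

text \<open>At each splitting node, first stabilise the set of strings above every successor, then
  thin out the successors by \<open>finite_limit_points\<close>; the bound on the cardinality is the
  same for all successors.\<close>

lemma fusion_null_translates:
  "\<exists>q\<le>p. \<forall>\<sigma>. splits q \<sigma> \<longrightarrow> finite {x. infinite {i. \<sigma> @ [i] \<in> tree_of q \<and>
     (\<exists>r\<le>cone q (\<sigma> @ [i]). res x i \<in> null_translates U r (length \<sigma>) i)}}"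
proof -
  \<comment> \<open>Quantifying over all \<open>r \<le> f i\<close> lets the finiteness pass from
    \<open>f i\<close> to the stronger cones of \<open>q\<close>.\<close>
  define P where "P \<sigma> B f \<longleftrightarrow> finite {x. infinite {i \<in> B. \<exists>r\<le>f i. res x i \<in> null_translates U r (length \<sigma>) i}}"
    for \<sigma> :: "nat list" and B :: "nat set" and f :: "nat \<Rightarrow> miller"
  have "\<exists>q\<le>p. \<forall>\<sigma>. splits q \<sigma> \<longrightarrow>
    (\<exists>B f. P \<sigma> B f \<and> (\<forall>i. \<sigma> @ [i] \<in> tree_of q \<longrightarrow> i \<in> B \<and> cone q (\<sigma> @ [i]) \<le> f i))"
  proof (rule miller_fusion)
    fix p \<sigma> assume \<sigma>: "splits p \<sigma>"
    let ?n = "length \<sigma>"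
    have "\<forall>i. \<exists>q. q \<le> cone p (\<sigma> @ [i]) \<and> (\<forall>r\<le>q. null_translates U r ?n i = null_translates U q ?n i)"
      by (intro allI stable_null_translates)
    then have "\<exists>f. \<forall>i. f i \<le> cone p (\<sigma> @ [i]) \<and> (\<forall>r\<le>f i. null_translates U r ?n i = null_translates U (f i) ?n i)"
      by (rule choice)
    then obtain f where f: "\<And>i. f i \<le> cone p (\<sigma> @ [i])"
      "\<And>i r. r \<le> f i \<Longrightarrow> null_translates U r ?n i = null_translates U (f i) ?n i"
      by blast
    obtain M where M: "\<And>q i. card (null_translates U (q::miller) ?n i) \<le> M" using card_null_translates by blast
    have "\<exists>B\<subseteq>{i. \<sigma> @ [i] \<in> tree_of p}. infinite B \<and> finite {x. infinite {i \<in> B. res x i \<in> null_translates U (f i) ?n i}}"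
      using \<sigma> M finite_null_translates by (intro finite_limit_points) (auto simp: splits_def)
    then obtain B where B: "B \<subseteq> {i. \<sigma> @ [i] \<in> tree_of p}" "infinite B"
      "finite {x. infinite {i \<in> B. res x i \<in> null_translates U (f i) ?n i}}" by blast
    have "(\<exists>r\<le>f i. res x i \<in> null_translates U r ?n i) \<longleftrightarrow> res x i \<in> null_translates U (f i) ?n i" for x i
      using f(2) by blast
    then have "P \<sigma> B f" using B(3) by (simp add: P_def)
    then show "\<exists>B f. infinite B \<and> (\<forall>i\<in>B. \<sigma> @ [i] \<in> tree_of p \<and> f i \<le> cone p (\<sigma> @ [i])) \<and> P \<sigma> B f"
      using B f(1) by blast
  qed
  then obtain q where q: "q \<le> p" "\<And>\<sigma>. splits q \<sigma> \<Longrightarrow>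
    \<exists>B f. P \<sigma> B f \<and> (\<forall>i. \<sigma> @ [i] \<in> tree_of q \<longrightarrow> i \<in> B \<and> cone q (\<sigma> @ [i]) \<le> f i)" by blast
  have "finite {x. infinite {i. \<sigma> @ [i] \<in> tree_of q \<and> (\<exists>r\<le>cone q (\<sigma> @ [i]). res x i \<in> null_translates U r (length \<sigma>) i)}}"
    if \<sigma>: "splits q \<sigma>" for \<sigma>
  proof -
    obtain B f where Bf: "P \<sigma> B f" "\<And>i. \<sigma> @ [i] \<in> tree_of q \<Longrightarrow> i \<in> B \<and> cone q (\<sigma> @ [i]) \<le> f i"
      using q(2)[OF \<sigma>] by blast
    have "{i. \<sigma> @ [i] \<in> tree_of q \<and> (\<exists>r\<le>cone q (\<sigma> @ [i]). res x i \<in> null_translates U r (length \<sigma>) i)}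
        \<subseteq> {i \<in> B. \<exists>r\<le>f i. res x i \<in> null_translates U r (length \<sigma>) i}" for x
      using Bf(2) order_trans by blast
    then show ?thesis
      using Bf(1) unfolding P_def by (elim rev_finite_subset) (blast dest: finite_subset)
  qed
  then show ?thesis using q(1) by blast
qed

subsection \<open>The Baire category argument\<close>

text \<open>If every cylinder of the cover were null outside \<open>U\<close>, so would be their
  finite union and hence \<open>A\<close>.\<close>

lemma bounded_outside_UN_refine:
  assumes "\<not> null_outside U p A" "A \<subseteq> (\<Union>t\<in>T. cyl t)" "finite T"
  shows "\<exists>q\<le>p. \<exists>t\<in>T. \<exists>\<delta>>0. bounded_outside U q (cyl t) \<delta>"
proof (rule ccontr)
  assume "\<not> ?thesis"
  then have "null_outside U p (cyl t)" if "t \<in> T" for t using that unfolding null_outside_def by blast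
  then have n: "null_outside U p (\<Union>t\<in>T. cyl t)" by (intro null_outside_UN assms(3)) auto
  obtain \<delta> q where \<delta>: "0 < \<delta>" "q \<le> p" "bounded_outside U q A \<delta>" using assms(1) unfolding null_outside_def by blast
  have "bounded_outside U q (\<Union>t\<in>T. cyl t) \<delta>"
    unfolding bounded_outside_def
  proof (intro allI impI)
    fix r F assume F: "r \<le> q" "finite F" "forces_subset F U r"
    then have "\<delta> \<le> measure cantor_measure (A - (\<Union>s\<in>F. cyl s))" using \<delta>(3) unfolding bounded_outside_def by blast
    also have "\<dots> \<le> measure cantor_measure ((\<Union>t\<in>T. cyl t) - (\<Union>s\<in>F. cyl s))"
      using assms(2,3) F(2) by (intro cantor.finite_measure_mono sets.Diff sets.finite_UN) auto
    finally show "\<delta> \<le> measure cantor_measure ((\<Union>t\<in>T. cyl t) - (\<Union>s\<in>F. cyl s))" .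
  qed
  then show False using n \<delta>(1,2) unfolding null_outside_def by blast
qed

text \<open>Otherwise one can build a name \<open>z\<close> along cylinders that keep positive
  measure outside \<open>U\<close> and enter \<open>x + Cset n (g n)\<close> for larger and larger
  \<open>n\<close>. Then \<open>x + z\<close> is in the limsup set, so \<open>z\<close> is in the
  sumset and must be covered by \<open>U\<close>, while no cylinder around it is.\<close>

lemma baire_category:
  assumes cover: "\<And>z r. r \<le> q \<Longrightarrow> fInSumset (check_set X) limsup_name z r \<Longrightarrow> \<exists>r'\<le>r. \<exists>s. (s \<^bold>\<in> U) r' \<and> fPrefix s z r'"
    and outside: "bounded_outside U q UNIV \<delta>0" "0 < \<delta>0" and x: "x \<in> X"
  shows "\<exists>r\<le>q. \<exists>s m \<delta>. 0 < \<delta> \<and> bounded_outside U r (cyl s) \<delta> \<and>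
    (\<forall>n\<ge>m. \<forall>r'\<le>r. \<forall>i. decides r' n i \<longrightarrow> null_outside U r' (cyl s \<inter> translate x (Cset n i)))"
proof (rule ccontr)
  assume contra: "\<not> ?thesis"
  \<comment> \<open>One step of the construction. Requiring \<open>n \<ge> length s\<close> makes
    the indices unbounded, and \<open>Clen n i \<le> length t\<close> makes \<open>t\<close> long
    enough to name a string of \<open>Cstrings n i\<close>.\<close>
  define \<phi> where "\<phi> r s t \<longleftrightarrow> strict_prefix s t \<and> (\<exists>\<delta>>0. bounded_outside U r (cyl t) \<delta>) \<and>
    (\<exists>n\<ge>length s. \<exists>i. decides r n i \<and> Clen n i \<le> length t \<and> cyl t \<subseteq> translate x (Cset n i))" for r s t
  have "\<exists>z. \<forall>r\<le>q. \<forall>j. \<exists>r'\<le>r. \<exists>s t. j \<le> length s \<and> \<phi> r' s t \<and> fPrefix t z r'"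
  proof (rule name_of_dependent_choice)
    show "\<phi> r' s t" if "\<phi> r s t" "r' \<le> r" for r r' s t
      using that unfolding \<phi>_def by (meson bounded_outside_mono decides_mono)
    show "strict_prefix s t" if "\<phi> r s t" for r s t
      using that unfolding \<phi>_def by blast
  next
    fix r t assume r: "r \<le> q" and t: "t = [] \<or> (\<exists>s. \<phi> r s t)"
    have "cyl [] = UNIV" by (simp add: cyl_def)
    then have "\<exists>\<delta>>0. bounded_outside U r (cyl t) \<delta>"
      using t outside bounded_outside_mono[OF outside(1) r] unfolding \<phi>_def by auto
    \<comment> \<open>The negated claim is applied to the cylinder of \<open>t\<close> with
      \<open>m = length t\<close>.\<close>
    then obtain n r1 i where n: "length t \<le> n" "r1 \<le> r" "decides r1 n i"
      "\<not> null_outside U r1 (cyl t \<inter> translate x (Cset n i))"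
      using contra r by blast
    \<comment> \<open>Longer than \<open>t\<close> to make the extension strict, and at least
      \<open>Clen n i\<close> so that each cylinder of length \<open>L\<close> is inside the
      translate or disjoint from it.\<close>
    define L where "L = max (Suc (length t)) (Clen n i)"
    define T where "T = {t'. length t' = L \<and> prefix t t' \<and> cyl t' \<subseteq> translate x (Cset n i)}"
    have "finite T" using finite_strings(1)[of L] by (rule rev_finite_subset) (auto simp: T_def)
    moreover have "cyl t \<inter> translate x (Cset n i) \<subseteq> (\<Union>t'\<in>T. cyl t')"
    proof
      fix z assume z: "z \<in> cyl t \<inter> translate x (Cset n i)"
      have "prefix t (res z L)"
      proof -
        have "t = res z (length t)" using z res_eq_iff[of z "length t" t] by auto
        also have "res z (length t) = take (length t) (res z L)"
          by (simp add: res_def take_map L_def)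
        finally show ?thesis by (metis take_is_prefix)
      qed
      moreover have "cyl (res z L) \<subseteq> translate x (Cset n i)"
      proof
        fix y assume "y \<in> cyl (res z L)"
        then have "\<forall>a<Clen n i. z a = y a" by (auto simp: cyl_def L_def)
        then show "y \<in> translate x (Cset n i)" using translate_Cset_local z by blast
      qed
      ultimately have "res z L \<in> T" by (simp add: T_def)
      moreover have "z \<in> cyl (res z L)" by (simp add: cyl_def)
      ultimately show "z \<in> (\<Union>t'\<in>T. cyl t')" by blast
    qed
    ultimately obtain r2 t' where t': "r2 \<le> r1" "t' \<in> T" "\<exists>\<delta>>0. bounded_outside U r2 (cyl t') \<delta>"
      using bounded_outside_UN_refine[OF n(4)] by blast
    have "strict_prefix t t'" using t'(2) by (auto simp: T_def L_def strict_prefix_def)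
    moreover have "Clen n i \<le> length t'" "cyl t' \<subseteq> translate x (Cset n i)"
      using t'(2) by (auto simp: T_def L_def)
    ultimately have "\<phi> r2 t t'"
      using t'(3) n(1) decides_mono[OF n(3) t'(1)] unfolding \<phi>_def by blast
    then show "\<exists>r'\<le>r. \<exists>t'. \<phi> r' t t'" using order_trans[OF t'(1) n(2)] by blast
  qed
  then obtain z where z: "\<And>r j. r \<le> q \<Longrightarrow> \<exists>r'\<le>r. \<exists>s t. j \<le> length s \<and> \<phi> r' s t \<and> fPrefix t z r'" by blast
  have "in_limsup (name_add x z) q"
    unfolding in_limsup_def
  proof (intro allI impI)
    fix m r assume "r \<le> q"
    then obtain r' s t where r': "r' \<le> r" "m \<le> length s" "\<phi> r' s t" "fPrefix t z r'" using z by blast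
    then obtain n i where n: "length s \<le> n" "decides r' n i" "Clen n i \<le> length t" "cyl t \<subseteq> translate x (Cset n i)"
      unfolding \<phi>_def by blast
    let ?u = "map (\<lambda>a. t ! a \<noteq> x a) [0..<Clen n i]"
    have "cyl ?u \<subseteq> Cset n i"
    proof
      fix y assume y: "y \<in> cyl ?u"
      \<comment> \<open>Padding \<open>t\<close> by zeros gives a point of \<open>cyl t\<close>;
        only its first \<open>Clen n i\<close> bits matter.\<close>
      define y' where "y' = (\<lambda>a. if a < length t then t ! a else False)"
      have "y' \<in> cyl t" by (simp add: cyl_def y'_def)
      then have "add2 y' x \<in> Cset n i" using n(4) unfolding translate_def by blast
      moreover have "\<forall>a<Clen n i. add2 y' x a = y a" using y n(3) by (simp add: cyl_def y'_def add2_def)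
      ultimately show "y \<in> Cset n i" using Cset_local by blast
    qed
    then have "?u \<in> Cstrings n i" by (simp add: Cstrings_def)
    moreover have "fPrefix ?u (name_add x z) r'"
    proof -
      have "((t ! a \<noteq> x a) \<noteq> x a) = t ! a" for a by blast
      then show ?thesis using r'(4) n(3) by (simp add: fPrefix_iff has_bit_name_add)
    qed
    ultimately show "\<exists>r'\<le>r. \<exists>n\<ge>m. \<exists>i. \<exists>u\<in>Cstrings n i. decides r' n i \<and> fPrefix u (name_add x z) r'"
      using r'(1,2) n(1,2) order_trans by blast
  qed
  then have "fInSumset (check_set X) limsup_name z q"
    using x by (intro fInSumset_name_add) (auto simp: limsup_name_def)
  then obtain r s where r: "r \<le> q" "(s \<^bold>\<in> U) r" "fPrefix s z r" using cover[OF order_refl] by blast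
  \<comment> \<open>Once \<open>t\<close> is at least as long as the string \<open>s\<close> that
    covers \<open>z\<close>, its cylinder lies inside that of \<open>s\<close>, so nothing of it is
    left outside \<open>U\<close>.\<close>
  obtain r' s' t where r': "r' \<le> r" "length s \<le> length s'" "\<phi> r' s' t" "fPrefix t z r'" using z[OF r(1)] by blast
  then obtain \<delta> where \<delta>: "0 < \<delta>" "bounded_outside U r' (cyl t) \<delta>" and l: "length s \<le> length t"
    unfolding \<phi>_def using prefix_length_less[of s' t] by fastforce
  have "cyl t \<subseteq> cyl s"
    using fPrefix_consistent[OF fPrefix_mono[OF r(3) r'(1)] r'(4)] l by (auto simp: cyl_def)
  then have "cyl t - (\<Union>s\<in>{s}. cyl s) = {}" by auto
  moreover have "forces_subset {s} U r'" using fElem_mono[OF r(2) r'(1)] by (simp add: forces_subset_def)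
  ultimately show False using \<delta> unfolding bounded_outside_def
    by (metis finite.intros measure_empty not_le order_refl)
qed

section \<open>Uncountable ground-model sets in the Miller extension\<close>

theorem lemma2p11:
  fixes X :: "(nat \<Rightarrow> bool) set"
  assumes "uncountable X"
  shows "\<^bold>\<tturnstile> \<^bold>\<not> fNullAdditive (check_set X :: miller set_name)"
  unfolding forced_def fNot_iff
proof (intro allI impI notI)
  fix p0 p :: miller assume "fNullAdditive (check_set X) p"
  then have "(fNull (\<lambda>x. fMem x limsup_name) \<^bold>\<longrightarrow> fNull (fInSumset (check_set X) limsup_name)) p"
    unfolding fNullAdditive_def fAll_iff by blast
  then obtain q where q: "fNull (fInSumset (check_set X) limsup_name) q"
    unfolding fImp_iff using fNull_limsup_name order_refl by blast
  \<comment> \<open>Level \<open>k = 1\<close> gives a cover of measure at most 1/2, which leaves at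
    least 1/2 outside.\<close>
  obtain q1 U where sum: "\<And>r F. r \<le> q1 \<Longrightarrow> finite F \<Longrightarrow> forces_subset F U r \<Longrightarrow> (\<Sum>s\<in>F. (1/2::real) ^ length s) \<le> (1/2) ^ 1"
    and cover: "\<And>z r. r \<le> q1 \<Longrightarrow> fInSumset (check_set X) limsup_name z r \<Longrightarrow> \<exists>r'\<le>r. \<exists>s. (s \<^bold>\<in> U) r' \<and> fPrefix s z r'"
    using q[unfolded fNull_iff, rule_format, OF order_refl, of 1] by blast
  have outside: "bounded_outside U q1 UNIV (1/2)"
    unfolding bounded_outside_def
  proof (intro allI impI)
    fix r F assume F: "r \<le> q1" "finite F" "forces_subset F U r"
    have "measure cantor_measure (\<Union>s\<in>F. cyl s) \<le> (\<Sum>s\<in>F. measure cantor_measure (cyl s))"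
      using F(2) by (intro measure_subadditive_finite) auto
    also have "\<dots> \<le> 1/2" using sum[OF F] by (simp add: measure_cyl)
    finally show "1/2 \<le> measure cantor_measure (UNIV - (\<Union>s\<in>F. cyl s))"
      using cantor.prob_compl[OF sets_UN_cyl[OF F(2)]] by simp
  qed
  obtain q2 where q2: "q2 \<le> q1" "\<And>\<sigma>. splits q2 \<sigma> \<Longrightarrow> finite {x. infinite {i. \<sigma> @ [i] \<in> tree_of q2 \<and>
     (\<exists>r\<le>cone q2 (\<sigma> @ [i]). res x i \<in> null_translates U r (length \<sigma>) i)}}"
    using fusion_null_translates by blast
  let ?G = "\<lambda>\<sigma>. {x. infinite {i. \<sigma> @ [i] \<in> tree_of q2 \<and>
     (\<exists>r\<le>cone q2 (\<sigma> @ [i]). res x i \<in> null_translates U r (length \<sigma>) i)}}"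
  have "X \<subseteq> (\<Union>\<sigma>\<in>{\<sigma>. splits q2 \<sigma>}. ?G \<sigma>)"
  proof
    fix x assume x: "x \<in> X"
    have "\<exists>r\<le>q2. \<exists>s m \<delta>. 0 < \<delta> \<and> bounded_outside U r (cyl s) \<delta> \<and>
        (\<forall>n\<ge>m. \<forall>r'\<le>r. \<forall>i. decides r' n i \<longrightarrow> null_outside U r' (cyl s \<inter> translate x (Cset n i)))"
      by (rule baire_category[OF _ bounded_outside_mono[OF outside q2(1)] _ x])
        (simp_all add: cover order_trans[OF _ q2(1)])
    then obtain r s m \<delta> where r: "r \<le> q2" "0 < \<delta>" "bounded_outside U r (cyl s) \<delta>"
      "\<And>n r' i. m \<le> n \<Longrightarrow> r' \<le> r \<Longrightarrow> decides r' n i \<Longrightarrow> null_outside U r' (cyl s \<inter> translate x (Cset n i))"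
      by blast
    obtain e where e: "1 / (real e + 1) < \<delta>"
      using reals_Archimedean[OF r(2)] by (auto simp: inverse_eq_divide add.commute)
    \<comment> \<open>The length of \<open>\<sigma>\<close> serves as \<open>n\<close>: at least
      \<open>e\<close> for the measure bound, at least \<open>length s\<close> for the cylinder, and
      at least \<open>m\<close> for the conclusion of the category argument.\<close>
    obtain \<sigma> where \<sigma>: "splits r \<sigma>" "max e (max m (length s)) \<le> length \<sigma>" using ex_splits_long by blast
    let ?n = "length \<sigma>"
    \<comment> \<open>The cone of \<open>r\<close> above a successor decides the Miller real at
      \<open>length \<sigma>\<close> to be \<open>i\<close>, so it witnesses that \<open>x\<close>
      is captured there. As \<open>r\<close> splits at \<open>\<sigma>\<close>, this happens for
      infinitely many \<open>i\<close>.\<close>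
    have "{i. \<sigma> @ [i] \<in> tree_of r} \<subseteq> {i. \<sigma> @ [i] \<in> tree_of q2 \<and> (\<exists>r\<le>cone q2 (\<sigma> @ [i]). res x i \<in> null_translates U r ?n i)}"
    proof
      fix i assume "i \<in> {i. \<sigma> @ [i] \<in> tree_of r}"
      then have i: "\<sigma> @ [i] \<in> tree_of r" by simp
      let ?r = "cone r (\<sigma> @ [i])"
      have "1 / (real ?n + 1) \<le> 1 / (real e + 1)" using \<sigma>(2) by (intro divide_left_mono) auto
      then have "bounded_outside U ?r (cyl s) (1 / (real ?n + 1))"
        using bounded_outside_mono[OF r(3) cone_le[OF i]] e unfolding bounded_outside_def by force
      moreover have "null_outside U ?r (cyl s \<inter> translate x (Cset ?n i))"
        using \<sigma>(2) by (intro r(4) cone_le[OF i] decides_cone[OF i]) auto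
      ultimately have "res x i \<in> null_translates U ?r ?n i"
        using \<sigma>(2) unfolding null_translates_def by auto
      moreover have "?r \<le> cone q2 (\<sigma> @ [i])" by (rule cone_mono[OF r(1) i])
      moreover have "\<sigma> @ [i] \<in> tree_of q2" using i r(1) by (auto simp: less_eq_miller_def)
      ultimately show "i \<in> {i. \<sigma> @ [i] \<in> tree_of q2 \<and> (\<exists>r\<le>cone q2 (\<sigma> @ [i]). res x i \<in> null_translates U r ?n i)}" by blast
    qed
    then have "x \<in> ?G \<sigma>" using \<sigma>(1) finite_subset unfolding splits_def by blast
    then show "x \<in> (\<Union>\<sigma>\<in>{\<sigma>. splits q2 \<sigma>}. ?G \<sigma>)" using splits_le[OF \<sigma>(1) r(1)] by blast
  qed
  moreover have "countable (\<Union>\<sigma>\<in>{\<sigma>. splits q2 \<sigma>}. ?G \<sigma>)"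
    using q2(2) by (intro countable_UN countableI_type countable_finite) auto
  ultimately show False using assms countable_subset by blast
qed

end
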